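(* Consider the distributed problem $\min_{x\in\mathbb{R}^d} f(x)=\sum_{i=1}^n f_i(x)$ and the q-PDGD algorithm with step-sizes $h_k$ (both described in the context). Assume: (1) $X^*=\arg\min_{x\in\mathbb{R}^d} f(x)$ is nonempty and convex; (2) each $f_i:\mathbb{R}^d\to\mathbb{R}$ is continuously differentiable and $\|\nabla f_i(a)-\nabla f_i(b)\|\le L_{f_i}\|a-b\|$ for all $a,b\in\mathbb{R}^d$, with $L_{f_i}>0$; put $L_f=\max_i L_{f_i}$; (3) (restricted secant inequality) there is $\nu>0$ with $(\nabla f(x)-\nabla f(\mathcal{P}_{X^*}(x)))^\top(x-\mathcal{P}_{X^*}(x))\ge \nu\|x-\mathcal{P}_{X^*}(x)\|^2$ for all $x\in\mathbb{R}^d$; (4) the set $\{\nabla F(\mathbf{x}):\mathbf{x}\in\mathcal{X}^*\}$ is a singleton; (5) the communication graph is undirected and connected; (6) the stochastic gradients are $g_i(x_i(k))=\nabla f_i(x_i(k))+\zeta_i(k)$ with $\mathbb{E}[\zeta_i(k)\mid\mathcal{F}_k]=0$ and $\mathbb{E}[\|\zeta_i(k)\|^2\mid\mathcal{F}_k]\le\sigma^2$ for all $i$ and $k$. Let the parameters satisfy $\alpha>\frac{2nL_f^2+\nu L_f}{\nu\rho_2(L)}$, $\beta>0$, and let the step-size be $h_k=\frac{\gamma}{k+1}$ with $\gamma>\frac{2\epsilon_3}{\epsilon_2}$, where $\epsilon_2,\epsilon_3$ are the explicit constants defined in the context. Then there exists a constant $C>0$ such that for all sufficiently large $k$, $$\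mathbb{E}\left[\|\mathbf{x}(k)-\mathcal{P}_{\mathcal{X}^*}(\mathbf{x}(k))\|^2\right]\le\frac{C}{k}.$$
   Context: **Notation.** $\|\cdot\|$ is the Euclidean norm; $\otimes$ is the Kronecker product; $\mathbf{1}_n$ is the all-ones vector in $\mathbb{R}^n$; $\mathcal{P}_S(x)=\arg\min_{y\in S}\|x-y\|^2$ is the projection onto $S$. Stacked quantities: $\mathbf{x}=\mathrm{col}(x_1,\dots,x_n)\in\mathbb{R}^{nd}$ with $x_i\in\mathbb{R}^d$, $F(\mathbf{x})=\sum_{i=1}^n f_i(x_i)$, $\mathcal{X}^*=\{\mathbf{1}_n\otimes x^*: x^*\in X^*\}$. **Network.** There are $n$ agents on a weighted undirected graph with symmetric adjacency matrix $(a_{ij})$, $a_{ij}\ge0$, $a_{ii}=0$; $i,j$ are adjacent iff $a_{ij}>0$. $L=(L_{ij})=D-(a_{ij})$ is the weighted Laplacian, $D$ the diagonal matrix of weighted degrees $\sum_j a_{ij}$. $\rho(L)$ is the spectral radius of $L$ and $\rho_2(L)$ its smallest nonzero eigenvalue. **Random quantizer.** Given $[l,u]$ and $b$ bits, let $\Delta=(u-l)/(2^b-1)$ and let $\tau_1=l<\dots<\tau_{2^b}=u$ be equally spaced with spacing $\Delta$. For $x\in[\tau_i,\tau_{i+1})$ and $p=(x-\tau_i)/\Delta$, $Q(x)=\tau_i$ with probability $1-p$ and $Q(x)=\tau_{i+1}$ with probability $p$; $Q$ is applied element-wise to vectors. **Algorithm q-PDGD.** With positive parameters $\alpha,\beta$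 and step-sizes $h_k>0$, arbitrary $x_i(0)\in\mathbb{R}^d$, and $v_i(0)=0$, for $k\ge0$ and each agent $i$: $$x_i(k+1)=x_i(k)-h_k\Big(\alpha\sum_{j=1}^nL_{ij}Q(x_j(k))+\beta v_i(k)+g_i(x_i(k))\Big),$$ $$v_i(k+1)=v_i(k)+h_k\beta\sum_{j=1}^nL_{ij}Q(x_j(k)),$$ where at each iteration the same realization $Q(x_j(k))$ is used everywhere, and $g_i(x_i(k))$ is a stochastic gradient. $\mathcal{F}_k$ is the filtration containing the history of all variables generated up to iteration $k$ (so $x_i(k),v_i(k)$ are $\mathcal{F}_k$-measurable). $\mathbb{E}[\cdot]$ is expectation over the randomness of the stochastic gradients and the quantization. **Quantization noise (standing).** $\varepsilon_i(k)=Q(x_i(k))-x_i(k)$ satisfies $\mathbb{E}[\varepsilon_i(k)\mid\mathcal{F}_k]=0$ and $\mathbb{E}[\|\varepsilon_i(k)\|^2\mid\mathcal{F}_k]\le d\Delta^2/4$ for all $i,k$ (properties of the random quantizer $Q$ with levels $\tau_1,\dots,\tau_{2^b}$ for inputs with coordinates in $[l,u]$). **Constants.** - $\nu_1=\min\left\{\frac{\nu}{2n},\ \alpha\rho_2(L)-\frac{2nL_f^2+\nu L_f}{\nu}\right\}$, - $\epsilon_1=\max\left\{\frac{1}{\nu_1}\left(\frac{L_f^2}{2\beta}+\beta\rho(L)\right),\frac12\right\}$, - $\epsilon_2=\min\left\{\frac{\beta}{2},\epsilon_1\nu_1\right\}$, - $\epsilon_3=\max\left\{\epsilon_1+\frac12,\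 \frac{\epsilon_1}{\rho_2(L)}+\frac{\alpha}{2\beta}+\frac12\right\}$. *)

theory Defs
  imports "HOL-Probability.Probability"
begin

definition gradient :: "('a::real_inner \<Rightarrow> real) \<Rightarrow> 'a \<Rightarrow> 'a" where
  "gradient f x = (THE D. GDERIV f x :> D)"

lemma gradient_eq:
  assumes "GDERIV f x :> D"
  shows "gradient f x = D"
proof -
  have "E = D" if "GDERIV f x :> E" for E
  proof -
    have "(\<lambda>h. inner h E) = (\<lambda>h. inner h D)"
      using has_derivative_unique that assms unfolding gderiv_def by blast
    then have "inner (E - D) E = inner (E - D) D"
      by meson
    then have "inner (E - D) (E - D) = 0"
      by (simp add: inner_diff_right)
    then show ?thesis
      by simp
  qed
  then show ?thesis
    unfolding gradient_def using assms by blast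
qed

definition continuously_differentiable :: "('a::real_inner \<Rightarrow> real) \<Rightarrow> bool" where
  "continuously_differentiable f \<longleftrightarrow>
     (\<forall>x. f differentiable (at x)) \<and> continuous_on UNIV (gradient f)"

definition minimizers :: "('a \<Rightarrow> real) \<Rightarrow> 'a set" where
  "minimizers f = {x. is_arg_min f (\<lambda>_. True) x}"

text \<open>Agents are the elements of a finite type \<open>'n\<close>. A stacked vector
  \<open>col(x\<^sub>1, \<dots>, x\<^sub>n)\<close> is an element of \<open>'a ^ 'n\<close>, whose norm is the Euclidean norm of the
  concatenation; the Kronecker product of the all-ones vector with \<open>y\<close> is \<open>vec y\<close>.\<close>

definition global_cost :: "('n::finite \<Rightarrow> 'a \<Rightarrow> real) \<Rightarrow> 'a \<Rightarrow> real" where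
  "global_cost f x = (\<Sum>i\<in>UNIV. f i x)"

definition stacked_cost :: "('n::finite \<Rightarrow> 'a \<Rightarrow> real) \<Rightarrow> 'a ^ 'n \<Rightarrow> real" where
  "stacked_cost f x = (\<Sum>i\<in>UNIV. f i (x $ i))"

definition weighted_undirected_graph :: "real ^ 'n ^ 'n \<Rightarrow> bool" where
  "weighted_undirected_graph A \<longleftrightarrow>
     (\<forall>i j. A $ i $ j = A $ j $ i) \<and> (\<forall>i j. 0 \<le> A $ i $ j) \<and> (\<forall>i. A $ i $ i = 0)"

definition graph_connected :: "real ^ 'n ^ 'n \<Rightarrow> bool" where
  "graph_connected A \<longleftrightarrow> (\<forall>i j. (\<lambda>i j. 0 < A $ i $ j)\<^sup>*\<^sup>* i j)"

definition laplacian :: "real ^ 'n ^ 'n \<Rightarrow> real ^ 'n ^ 'n::finite" where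
  "laplacian A = (\<chi> i j. if i = j then \<Sum>k\<in>UNIV. A $ i $ k else 0) - A"

definition eigenvalues :: "'a::field ^ 'n ^ 'n::finite \<Rightarrow> 'a set" where
  "eigenvalues A = {c. \<exists>v. v \<noteq> 0 \<and> A *v v = c *s v}"

definition spectral_radius :: "real ^ 'n ^ 'n::finite \<Rightarrow> real" where
  "spectral_radius A = Max (cmod ` eigenvalues (map_matrix complex_of_real A))"

text \<open>Only meaningful if \<open>A\<close> has a nonzero real eigenvalue. The Laplacian of a connected graph
  with at least two vertices has one; on a single vertex it has none.\<close>

definition min_nonzero_eigenvalue :: "real ^ 'n ^ 'n::finite \<Rightarrow> real" where
  "min_nonzero_eigenvalue A = Min (eigenvalues A - {0})"

definition vec_cond_exp ::
    "'w measure \<Rightarrow> 'w measure \<Rightarrow> ('w \<Rightarrow> real ^ 'd) \<Rightarrow> 'w \<Rightarrow> real ^ 'd::finite" where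
  "vec_cond_exp M G X = (\<lambda>\<omega>. \<chi> c. real_cond_exp M G (\<lambda>\<omega>. X \<omega> $ c) \<omega>)"

definition cond_prob :: "'w measure \<Rightarrow> 'w measure \<Rightarrow> ('w \<Rightarrow> bool) \<Rightarrow> 'w \<Rightarrow> real" where
  "cond_prob M G P = real_cond_exp M G (indicat_real {\<omega> \<in> space M. P \<omega>})"

definition quant_step :: "real \<Rightarrow> real \<Rightarrow> nat \<Rightarrow> real" where
  "quant_step l u b = (u - l) / (2 ^ b - 1)"

text \<open>Levels are indexed from 1: level \<open>1\<close> is \<open>l\<close> and level \<open>2 ^ b\<close> is \<open>u\<close>.\<close>

definition quant_level :: "real \<Rightarrow> real \<Rightarrow> nat \<Rightarrow> nat \<Rightarrow> real" where
  "quant_level l u b m = l + (real m - 1) * quant_step l u b"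

text \<open>The real random variable \<open>q\<close> is a random quantization of \<open>x\<close>, given the information \<open>G\<close>
  (for which \<open>x\<close> is measurable). Nothing is prescribed where \<open>x\<close> lies outside \<open>[l, u)\<close>.\<close>

definition random_quantization ::
    "real \<Rightarrow> real \<Rightarrow> nat \<Rightarrow> 'w measure \<Rightarrow> 'w measure \<Rightarrow> ('w \<Rightarrow> real) \<Rightarrow> ('w \<Rightarrow> real) \<Rightarrow> bool" where
  "random_quantization l u b M G x q \<longleftrightarrow>
     (\<forall>m \<in> {1..<2 ^ b}. AE \<omega> in M.
        quant_level l u b m \<le> x \<omega> \<and> x \<omega> < quant_level l u b (m + 1) \<longrightarrow>
        (let p = (x \<omega> - quant_level l u b m) / quant_step l u b in
          cond_prob M G (\<lambda>\<omega>. q \<omega> = quant_level l u b m) \<omega> = 1 - p \<and>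
          cond_prob M G (\<lambda>\<omega>. q \<omega> = quant_level l u b (m + 1)) \<omega> = p))"

text \<open>One trajectory of the algorithm: \<open>x\<close>, \<open>v\<close> are the iterates, \<open>q k\<close> is the realization of
  the quantized stacked state and \<open>g k\<close> the realization of the stacked stochastic gradient
  at iteration \<open>k\<close>.\<close>

definition q_pdgd_trajectory ::
    "real ^ 'n ^ 'n \<Rightarrow> real \<Rightarrow> real \<Rightarrow> (nat \<Rightarrow> real) \<Rightarrow>
     (nat \<Rightarrow> real ^ 'd ^ 'n) \<Rightarrow> (nat \<Rightarrow> real ^ 'd ^ 'n) \<Rightarrow>
     (nat \<Rightarrow> real ^ 'd ^ 'n) \<Rightarrow> (nat \<Rightarrow> real ^ 'd ^ 'n::finite) \<Rightarrow> bool" where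
  "q_pdgd_trajectory L \<alpha> \<beta> h x v q g \<longleftrightarrow>
     (\<forall>i. v 0 $ i = 0) \<and>
     (\<forall>k i. x (k + 1) $ i =
        x k $ i - h k *\<^sub>R (\<alpha> *\<^sub>R (\<Sum>j\<in>UNIV. L $ i $ j *\<^sub>R q k $ j) + \<beta> *\<^sub>R v k $ i + g k $ i)) \<and>
     (\<forall>k i. v (k + 1) $ i = v k $ i + (h k * \<beta>) *\<^sub>R (\<Sum>j\<in>UNIV. L $ i $ j *\<^sub>R q k $ j))"

end

theory Submission
  imports Defs
begin

text \<open>
  Up to zero-mean noise, the algorithm is an explicit Euler scheme for the primal-dual flow
  \<open>x' = - (\<alpha> L x + \<beta> v + \<nabla>F x)\<close>, \<open>v' = \<beta> L x\<close>. Let \<open>z\<close> be the difference of \<open>x\<close> and its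
  projection onto the consensual minimisers, and let \<open>w\<close> be the difference of \<open>v\<close> and the
  multiplier \<open>v\<^sub>* = - \<nabla>F(x\<^sub>*) / \<beta>\<close>, which is the same for all consensual minimisers \<open>x\<^sub>*\<close>
  because \<open>\<nabla>F\<close> is constant on them. Since \<open>v\<close> starts at \<open>0\<close> and moves in the range of \<open>L\<close>, and
  since the components of \<open>\<nabla>F(x\<^sub>*)\<close> sum to \<open>\<nabla>f = 0\<close>, the vector \<open>w\<close> is always orthogonal to
  consensus. With a right inverse \<open>T\<close> of \<open>L\<close> on these vectors, the Lyapunov function is
  \<open>V = \<epsilon>\<^sub>1 (z \<bullet> z + w \<bullet> T w) + (z \<bullet> w + \<alpha> / (2 \<beta>) (w \<bullet> w))\<close>.

  Along the flow the coupling terms inside the first bracket cancel, which leaves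
  \<open>- 2 z \<bullet> (\<alpha> L z + \<nabla>F x - \<nabla>F x\<^sub>*)\<close>. This is at most \<open>- 2 \<nu>\<^sub>1 (norm z)\<^sup>2\<close>: the spectral gap
  controls the disagreement between the agents, and the restricted secant inequality controls their
  average (\<open>restricted_strong_monotonicity\<close>). The second bracket produces the missing term
  \<open>- \<beta> (norm w)\<^sup>2\<close>, at the price of a multiple of \<open>(norm z)\<^sup>2\<close> that is dominated by the choice of
  \<open>\<epsilon>\<^sub>1\<close>. So \<open>V\<close> decreases at the rate \<open>\<epsilon>\<^sub>2 ((norm z)\<^sup>2 + (norm w)\<^sup>2) \<ge> (\<epsilon>\<^sub>2 / \<epsilon>\<^sub>3) V\<close>.

  In discrete time \<open>V\<close> is a quadratic form, so a step adds \<open>h\<^sub>k\<close> times the derivative above, a noise term that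
  is linear in the noise and has expectation zero, and a second-order term bounded by
  \<open>h\<^sub>k\<^sup>2\<close> times a multiple of \<open>V\<close> plus the noise variance (\<open>lyapunov_decrease\<close>,
  \<open>increments_bound\<close>). The projection moves with \<open>x\<close>, but keeping the old projection in the
  next step can only increase \<open>V\<close> (\<open>lyapunov_mono\<close>). Taking expectations gives a recursion
  of Chung's type with leading coefficient \<open>\<gamma> \<epsilon>\<^sub>2 / \<epsilon>\<^sub>3 > 2\<close>, whose solutions are \<open>O(1 / k)\<close>
  (\<open>decay_rate_inverse\<close>). Finally \<open>V\<close> dominates a multiple of \<open>(norm z)\<^sup>2\<close>
  (\<open>lyapunov_lower\<close>).
\<close>

section \<open>Gradients and minimisers\<close>

lemma gderiv_gradient:
  fixes f :: "'a::euclidean_space \<Rightarrow> real"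
  assumes "f differentiable (at x)"
  shows "GDERIV f x :> gradient f x"
proof -
  obtain f' where f': "(f has_derivative f') (at x)"
    using assms differentiable_def by blast
  then have "linear f'"
    by (rule has_derivative_linear)
  then have "f' = (\<lambda>h. inner h (adjoint f' 1))"
    using adjoint_works[of f' _ 1] by (simp add: fun_eq_iff)
  then have "GDERIV f x :> adjoint f' 1"
    using f' unfolding gderiv_def by simp
  then show ?thesis
    using gradient_eq by metis
qed

lemma gradient_global_cost:
  fixes f :: "'n::finite \<Rightarrow> 'a::euclidean_space \<Rightarrow> real"
  assumes "\<And>i. f i differentiable (at y)"
  shows "GDERIV (global_cost f) y :> (\<Sum>i\<in>UNIV. gradient (f i) y)"
  using gderiv_gradient[OF assms] unfolding gderiv_def global_cost_def[abs_def] inner_sum_right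
  by (intro has_derivative_sum) auto

lemma gradient_stacked_cost:
  fixes f :: "'n::finite \<Rightarrow> 'a::euclidean_space \<Rightarrow> real"
  assumes "\<And>i. f i differentiable (at (x $ i))"
  shows "GDERIV (stacked_cost f) x :> (\<chi> i. gradient (f i) (x $ i))"
proof -
  have "((\<lambda>x. f i (x $ i)) has_derivative (\<lambda>h. h $ i \<bullet> gradient (f i) (x $ i))) (at x)" for i
    using gderiv_gradient[OF assms, of i] unfolding gderiv_def
    by (rule has_derivative_compose[OF bounded_linear_imp_has_derivative[OF bounded_linear_vec_nth]])
  then show ?thesis
    unfolding gderiv_def stacked_cost_def[abs_def] inner_vec_def
    by (auto intro!: has_derivative_sum)
qed

lemma gradient_minimizer:
  fixes f :: "'a::euclidean_space \<Rightarrow> real"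
  assumes "y \<in> minimizers f" and D: "GDERIV f y :> D"
  shows "D = 0"
proof -
  have "(\<lambda>h. inner h D) = (\<lambda>h. 0)"
  proof (rule differential_zero_maxmin[where S = UNIV])
    show "(\<forall>z\<in>UNIV. f z \<le> f y) \<or> (\<forall>z\<in>UNIV. f y \<le> f z)"
      using assms(1) by (auto simp: minimizers_def is_arg_min_linorder)
  qed (use D in \<open>auto simp: gderiv_def\<close>)
  then show ?thesis
    by (metis inner_eq_zero_iff)
qed

lemma closed_minimizers:
  fixes f :: "'a::topological_space \<Rightarrow> real"
  assumes "continuous_on UNIV f"
  shows "closed (minimizers f)"
proof -
  have "minimizers f = (\<Inter>z. {x. f x \<le> f z})"
    by (auto simp: minimizers_def is_arg_min_linorder)
  then show ?thesis
    by (auto intro!: closed_INT closed_Collect_le assms continuous_on_const)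
qed

section \<open>Extremal eigenvalues of symmetric matrices\<close>

text \<open>A minimiser of the Rayleigh quotient over the unit sphere of an invariant subspace is an
  eigenvector. This single eigenvector gives the extremal eigenvalues; no full diagonalisation is
  involved.\<close>

lemma rayleigh_minimum:
  fixes T :: "'a::euclidean_space \<Rightarrow> 'a"
  assumes T: "linear T" "\<And>x y. T x \<bullet> y = x \<bullet> T y"
    and S: "subspace S" "\<And>x. x \<in> S \<Longrightarrow> T x \<in> S" "S \<noteq> {0}"
  obtains \<mu> v where "v \<in> S" "norm v = 1" "T v = \<mu> *\<^sub>R v"
    "\<And>x. x \<in> S \<Longrightarrow> \<mu> * (norm x)\<^sup>2 \<le> x \<bullet> T x"
proof -
  have "compact (sphere 0 1 \<inter> S)"
    by (intro compact_Int_closed closed_subspace S) auto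
  moreover have "sphere 0 1 \<inter> S \<noteq> {}"
  proof -
    obtain x where "x \<in> S" "x \<noteq> 0"
      using S subspace_0 by blast
    then have "x /\<^sub>R norm x \<in> sphere 0 1 \<inter> S"
      using S(1) by (auto simp: subspace_scale)
    then show ?thesis
      by blast
  qed
  moreover have "continuous_on (sphere 0 1 \<inter> S) (\<lambda>x. x \<bullet> T x)"
    by (intro continuous_on_inner continuous_on_id linear_continuous_on linear_conv_bounded_linear[THEN iffD1] T)
  ultimately obtain v where v: "v \<in> sphere 0 1 \<inter> S"
    and min: "\<And>x. x \<in> sphere 0 1 \<inter> S \<Longrightarrow> v \<bullet> T v \<le> x \<bullet> T x"
    using continuous_attains_inf[of "sphere 0 1 \<inter> S" "\<lambda>x. x \<bullet> T x"] by blast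
  define \<mu> where "\<mu> = v \<bullet> T v"
  have ge: "\<mu> * (norm x)\<^sup>2 \<le> x \<bullet> T x" if "x \<in> S" for x
  proof (cases "x = 0")
    case False
    have "x /\<^sub>R norm x \<in> sphere 0 1 \<inter> S"
      using that S(1) False by (auto simp: subspace_scale)
    from min[OF this] have "\<mu> \<le> (x \<bullet> T x) / (norm x)\<^sup>2"
      by (simp add: \<mu>_def linear_scale[OF T(1)] power2_eq_square divide_inverse ac_simps)
    with False show ?thesis
      by (simp add: pos_le_divide_eq)
  qed (simp add: linear_0[OF T(1)])
  define d where "d = T v - \<mu> *\<^sub>R v"
  have dS: "d \<in> S"
    unfolding d_def using v S by (simp add: subspace_diff subspace_scale)
  \<comment> \<open>The form \<open>x \<bullet> T x - \<mu> * (norm x)\<^sup>2\<close> is nonnegative and vanishes at \<open>v\<close>, so its derivative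
    at \<open>v\<close> in the direction of the residual \<open>d\<close>, which is \<open>2 * (norm d)\<^sup>2\<close>, has to vanish.\<close>
  define c where "c = d \<bullet> T d - \<mu> * (norm d)\<^sup>2"
  have pert: "0 \<le> 2 * t * (norm d)\<^sup>2 + t\<^sup>2 * c" for t
  proof -
    have "v + t *\<^sub>R d \<in> S"
      using v S dS by (simp add: subspace_add subspace_scale)
    from ge[OF this]
    have "0 \<le> (v + t *\<^sub>R d) \<bullet> T (v + t *\<^sub>R d) - \<mu> * ((v + t *\<^sub>R d) \<bullet> (v + t *\<^sub>R d))"
      by (simp add: power2_norm_eq_inner)
    also have "\<dots> = (v \<bullet> T v - \<mu> * (v \<bullet> v)) + 2 * t * (d \<bullet> T v - \<mu> * (d \<bullet> v)) + t\<^sup>2 * c"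
      using T(2)[of v d] unfolding c_def power2_norm_eq_inner
      by (simp add: linear_add[OF T(1)] linear_scale[OF T(1)] inner_add_left inner_add_right
          inner_commute power2_eq_square algebra_simps)
    also have "v \<bullet> T v - \<mu> * (v \<bullet> v) = 0"
      using v by (simp add: \<mu>_def dot_square_norm)
    also have "d \<bullet> T v - \<mu> * (d \<bullet> v) = (norm d)\<^sup>2"
      by (simp add: d_def power2_norm_eq_inner inner_diff_right)
    finally show ?thesis
      by simp
  qed
  have "d = 0"
  proof (rule ccontr)
    assume "d \<noteq> 0"
    define N where "N = (norm d)\<^sup>2"
    have "N > 0"
      using \<open>d \<noteq> 0\<close> by (simp add: N_def)
    define t where "t = - (N / (\<bar>c\<bar> + 1))"
    have "t < 0" using \<open>N > 0\<close> by (simp add: t_def)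
    have "N * c \<le> N * \<bar>c\<bar>"
      using \<open>N > 0\<close> by (intro mult_left_mono) auto
    then have "N * c \<le> N * (\<bar>c\<bar> + 1)"
      using \<open>N > 0\<close> by (simp only: distrib_left)
    then have "\<bar>t\<bar> * c \<le> N"
      using \<open>N > 0\<close> by (simp add: t_def abs_mult pos_divide_le_eq)
    then have "2 * N + t * c > 0"
      using \<open>t < 0\<close> \<open>N > 0\<close> by simp
    then have "t * (2 * N + t * c) < 0"
      using \<open>t < 0\<close> by (simp add: mult_neg_pos)
    with pert[of t] show False
      by (simp add: N_def power2_eq_square algebra_simps)
  qed
  then show ?thesis
    using v ge by (intro that[of v \<mu>]) (auto simp: d_def)
qed


text \<open>Eigenvectors to different eigenvalues are orthogonal, hence independent. Finiteness gives the
  minimum and the maximum in the definitions of the spectral constants their meaning.\<close>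

lemma finite_eigenvalues_symmetric:
  fixes B :: "real ^ 'n ^ 'n"
  assumes sym: "transpose B = B"
  shows "finite (eigenvalues B)"
proof -
  have "\<forall>c\<in>eigenvalues B. \<exists>v. v \<noteq> 0 \<and> B *v v = c *\<^sub>R v"
    by (auto simp: eigenvalues_def scalar_mult_eq_scaleR)
  then obtain v where nz: "\<And>c. c \<in> eigenvalues B \<Longrightarrow> v c \<noteq> 0"
    and v: "\<And>c. c \<in> eigenvalues B \<Longrightarrow> B *v v c = c *\<^sub>R v c"
    by metis
  have orth: "v c \<bullet> v d = 0" if "c \<in> eigenvalues B" "d \<in> eigenvalues B" "c \<noteq> d" for c d
  proof -
    have "(B *v v c) \<bullet> v d = v c \<bullet> (B *v v d)"
      by (metis dot_lmul_matrix sym transpose_matrix_vector)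
    then have "(c - d) * (v c \<bullet> v d) = 0"
      by (simp add: v that algebra_simps)
    then show ?thesis
      using that by simp
  qed
  have "inj_on v (eigenvalues B)"
    using orth nz by (intro inj_onI) (metis inner_eq_zero_iff)
  moreover have "pairwise orthogonal (v ` eigenvalues B)"
    using orth by (auto simp: pairwise_def orthogonal_def)
  then have "independent (v ` eigenvalues B)"
    by (rule pairwise_orthogonal_independent) (use nz in force)
  then have "finite (v ` eigenvalues B)"
    by (rule independent_imp_finite)
  ultimately show ?thesis
    using finite_imageD by blast
qed

text \<open>The spectral radius is defined by complex eigenvalues; for a symmetric real matrix these are
  the real ones. For an eigenvector \<open>a + \<i> b\<close> to \<open>c\<close>, symmetry of the form applied to \<open>a\<close> and
  \<open>b\<close> gives \<open>Im c * (a \<bullet> a + b \<bullet> b) = 0\<close>, and the real or the imaginary part is then a real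
  eigenvector.\<close>

lemma eigenvalues_complexification:
  fixes B :: "real ^ 'n ^ 'n"
  assumes sym: "transpose B = B"
  shows "eigenvalues (map_matrix complex_of_real B) = complex_of_real ` eigenvalues B"
proof (intro equalityI subsetI)
  fix c assume "c \<in> eigenvalues (map_matrix complex_of_real B)"
  then obtain w where w: "w \<noteq> 0" "map_matrix complex_of_real B *v w = c *s w"
    by (auto simp: eigenvalues_def)
  define a where "a = (\<chi> i. Re (w $ i))"
  define b where "b = (\<chi> i. Im (w $ i))"
  have eq: "(\<Sum>j\<in>UNIV. complex_of_real (B $ i $ j) * w $ j) = c * w $ i" for i
    using arg_cong[OF w(2), of "\<lambda>u. u $ i"]
    by (simp add: matrix_vector_mult_def map_matrix_def)
  have Ba: "B *v a = Re c *\<^sub>R a - Im c *\<^sub>R b"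
    using arg_cong[OF eq, of Re] by (simp add: vec_eq_iff matrix_vector_mult_def a_def b_def)
  have Bb: "B *v b = Im c *\<^sub>R a + Re c *\<^sub>R b"
    using arg_cong[OF eq, of Im] by (simp add: vec_eq_iff matrix_vector_mult_def a_def b_def)
  have "(B *v a) \<bullet> b = a \<bullet> (B *v b)"
    by (metis dot_lmul_matrix sym transpose_matrix_vector)
  then have "Im c * (a \<bullet> a + b \<bullet> b) = 0"
    by (simp add: Ba Bb inner_simps algebra_simps)
  moreover have nz: "a \<noteq> 0 \<or> b \<noteq> 0"
    using w(1) by (auto simp: vec_eq_iff a_def b_def complex_eq_iff)
  then have "a \<bullet> a + b \<bullet> b > 0"
    by (metis add_nonneg_pos add_pos_nonneg inner_ge_zero inner_gt_zero_iff)
  ultimately have im: "Im c = 0"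
    by simp
  then have "Re c \<in> eigenvalues B"
    using nz Ba Bb by (auto simp: eigenvalues_def scalar_mult_eq_scaleR)
  moreover have "c = complex_of_real (Re c)"
    using im by (simp add: complex_eq_iff)
  ultimately show "c \<in> complex_of_real ` eigenvalues B"
    by blast
next
  fix c assume "c \<in> complex_of_real ` eigenvalues B"
  then obtain r v where v: "c = complex_of_real r" "v \<noteq> 0" "B *v v = r *\<^sub>R v"
    by (auto simp: eigenvalues_def scalar_mult_eq_scaleR)
  define w where "w = (\<chi> i. complex_of_real (v $ i))"
  have "(\<Sum>j\<in>UNIV. B $ i $ j * v $ j) = r * v $ i" for i
    using arg_cong[OF v(3), of "\<lambda>u. u $ i"] by (simp add: matrix_vector_mult_def)
  from arg_cong[OF this, of complex_of_real]
  have "map_matrix complex_of_real B *v w = c *s w"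
    by (simp add: vec_eq_iff matrix_vector_mult_def map_matrix_def w_def v)
  moreover have "w \<noteq> 0"
    using v(2) by (auto simp: vec_eq_iff w_def)
  ultimately show "c \<in> eigenvalues (map_matrix complex_of_real B)"
    by (auto simp: eigenvalues_def)
qed

text \<open>The minimum of the Rayleigh quotient of \<open>- B\<close> is attained at an eigenvector of \<open>B\<close>.\<close>

lemma quadratic_form_le_spectral_radius:
  fixes B :: "real ^ 'n ^ 'n"
  assumes sym: "transpose B = B"
  shows "x \<bullet> (B *v x) \<le> spectral_radius B * (norm x)\<^sup>2"
proof -
  have lin: "linear (\<lambda>x. - (B *v x))"
    by (intro linear_compose_neg matrix_vector_mul_linear)
  have self: "- (B *v x) \<bullet> y = x \<bullet> - (B *v y)" for x y
    by (simp add: dot_lmul_matrix[symmetric] transpose_matrix_vector[symmetric] sym)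
  obtain \<mu> v where v: "norm v = 1" "- (B *v v) = \<mu> *\<^sub>R v"
    and le: "\<And>x. x \<in> UNIV \<Longrightarrow> \<mu> * (norm x)\<^sup>2 \<le> x \<bullet> - (B *v x)"
    by (rule rayleigh_minimum[OF lin self subspace_UNIV]) (auto simp: UNIV_not_singleton)
  have "B *v v = (- \<mu>) *\<^sub>R v"
    using v(2) by (metis minus_minus scaleR_minus_left)
  moreover have "v \<noteq> 0"
    using v(1) by auto
  ultimately have "- \<mu> \<in> eigenvalues B"
    unfolding eigenvalues_def scalar_mult_eq_scaleR by blast
  then have "cmod (complex_of_real (- \<mu>)) \<le> spectral_radius B"
    unfolding spectral_radius_def eigenvalues_complexification[OF sym]
    by (intro Max_ge finite_imageI finite_eigenvalues_symmetric[OF sym]) blast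
  then have "- \<mu> \<le> spectral_radius B"
    by simp
  then have "- \<mu> * (norm x)\<^sup>2 \<le> spectral_radius B * (norm x)\<^sup>2"
    by (intro mult_right_mono) auto
  with le[of x] show ?thesis
    by simp
qed

section \<open>The Laplacian of a connected graph\<close>

lemma laplacian_symmetric:
  assumes "weighted_undirected_graph A"
  shows "transpose (laplacian A) = laplacian A"
  using assms by (auto simp: weighted_undirected_graph_def laplacian_def transpose_def vec_eq_iff)

lemma laplacian_row_sum: "(\<Sum>j\<in>UNIV. laplacian A $ i $ j) = 0"
  by (simp add: laplacian_def sum_subtractf)

lemma laplacian_mult:
  "(laplacian A *v x) $ i = (\<Sum>j\<in>UNIV. A $ i $ j * (x $ i - x $ j))"
  by (simp add: laplacian_def matrix_vector_mult_def left_diff_distrib right_diff_distrib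
      sum_subtractf sum_distrib_right if_distrib[of "\<lambda>z. z * _"] cong: if_cong)

lemma laplacian_quadratic_form:
  assumes "weighted_undirected_graph A"
  shows "x \<bullet> (laplacian A *v x) = (\<Sum>i\<in>UNIV. \<Sum>j\<in>UNIV. A $ i $ j * (x $ i - x $ j)\<^sup>2) / 2"
proof -
  let ?s = "\<Sum>i\<in>UNIV. \<Sum>j\<in>UNIV. A $ i $ j * (x $ i * (x $ i - x $ j))"
  have "x \<bullet> (laplacian A *v x) = ?s"
    by (simp add: inner_vec_def laplacian_mult sum_distrib_left mult.left_commute)
  moreover have "?s = (\<Sum>i\<in>UNIV. \<Sum>j\<in>UNIV. A $ i $ j * (x $ j * (x $ j - x $ i)))"
    using assms by (subst sum.swap) (auto simp: weighted_undirected_graph_def intro!: sum.cong)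
  ultimately have "2 * (x \<bullet> (laplacian A *v x)) =
      (\<Sum>i\<in>UNIV. \<Sum>j\<in>UNIV. A $ i $ j * (x $ i * (x $ i - x $ j)) + A $ i $ j * (x $ j * (x $ j - x $ i)))"
    by (simp add: sum.distrib)
  also have "\<dots> = (\<Sum>i\<in>UNIV. \<Sum>j\<in>UNIV. A $ i $ j * (x $ i - x $ j)\<^sup>2)"
    by (intro sum.cong refl) (simp add: power2_eq_square algebra_simps)
  finally show ?thesis
    by simp
qed

lemma laplacian_nonneg:
  assumes "weighted_undirected_graph A"
  shows "0 \<le> x \<bullet> (laplacian A *v x)"
  unfolding laplacian_quadratic_form[OF assms]
  using assms by (auto simp: weighted_undirected_graph_def intro!: sum_nonneg)

text \<open>A zero of the Dirichlet form is constant along edges, hence along paths.\<close>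

lemma laplacian_kernel:
  assumes A: "weighted_undirected_graph A" "graph_connected A"
    and "x \<bullet> (laplacian A *v x) = 0"
  shows "x $ i = x $ j"
proof -
  have nn: "0 \<le> A $ i $ j * (x $ i - x $ j)\<^sup>2" for i j
    using A(1) by (auto simp: weighted_undirected_graph_def)
  have "A $ i $ j * (x $ i - x $ j)\<^sup>2 = 0" for i j
    using assms(3) unfolding laplacian_quadratic_form[OF A(1)]
    by (simp add: sum_nonneg_eq_0_iff sum_nonneg nn)
  then have step: "x $ i = x $ j" if "0 < A $ i $ j" for i j
    using that by (metis eq_iff_diff_eq_0 mult_eq_0_iff order_less_irrefl power_not_zero)
  have "(\<lambda>i j. 0 < A $ i $ j)\<^sup>*\<^sup>* i j"
    using A(2) by (auto simp: graph_connected_def)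
  then show ?thesis
    by induction (auto dest: step)
qed

text \<open>The vectors with component sum zero are orthogonal to the kernel of the Laplacian, so the
  minimum of the Rayleigh quotient over them is a nonzero eigenvalue, and it is at least the smallest
  one. With two vertices such vectors exist, which makes the minimum in the definition of
  \<open>\<kappa>\<close> a minimum over a nonempty set.\<close>

lemma min_nonzero_eigenvalue_laplacian:
  fixes A :: "real ^ 'n ^ 'n"
  assumes A: "weighted_undirected_graph A" "graph_connected A" and n: "2 \<le> CARD('n)"
  defines "\<kappa> \<equiv> min_nonzero_eigenvalue (laplacian A)"
  shows "0 < \<kappa>"
    and "(\<Sum>i\<in>UNIV. x $ i) = 0 \<Longrightarrow> \<kappa> * (norm x)\<^sup>2 \<le> x \<bullet> (laplacian A *v x)"
    and "\<kappa> \<le> spectral_radius (laplacian A)"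
proof -
  let ?L = "laplacian A"
  note sym = laplacian_symmetric[OF A(1)]
  define S where "S = {x :: real ^ 'n. (\<Sum>i\<in>UNIV. x $ i) = 0}"
  have self: "(?L *v x) \<bullet> y = x \<bullet> (?L *v y)" for x y
    by (metis dot_lmul_matrix sym transpose_matrix_vector)
  have sub: "subspace S"
    by (auto simp: S_def subspace_def sum.distrib simp flip: sum_distrib_left)
  have inv: "?L *v x \<in> S" if "x \<in> S" for x
  proof -
    have "(\<Sum>i\<in>UNIV. (?L *v x) $ i) = (?L *v x) \<bullet> 1"
      by (simp add: inner_vec_def)
    also have "\<dots> = x \<bullet> (?L *v 1)"
      by (rule self)
    also have "?L *v 1 = 0"
      by (simp add: vec_eq_iff laplacian_mult)
    finally show ?thesis
      by (simp add: S_def)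
  qed
  have "S \<noteq> {0}"
  proof -
    obtain i j :: 'n where ij: "i \<noteq> j"
      using n by (metis card_2_iff' card_le_Suc0_iff_eq finite_UNIV_card_ge_0 finite not_less_eq_eq numeral_2_eq_2 UNIV_I)
    then have "axis i 1 - axis j 1 \<in> S"
      by (simp add: S_def sum_subtractf axis_def)
    moreover have "axis i 1 - axis j (1::real) \<noteq> 0"
      using ij by (simp add: axis_eq_axis)
    ultimately show ?thesis
      by blast
  qed
  then obtain \<mu> v where v: "v \<in> S" "norm v = 1" "?L *v v = \<mu> *\<^sub>R v"
    and min: "\<And>x. x \<in> S \<Longrightarrow> \<mu> * (norm x)\<^sup>2 \<le> x \<bullet> (?L *v x)"
    using rayleigh_minimum[OF matrix_vector_mul_linear self sub inv] by metis
  have "v \<noteq> 0"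
    using v(2) by auto
  have "\<mu> \<noteq> 0"
  proof
    assume "\<mu> = 0"
    then have eq: "v $ i = v $ j" for i j
      using laplacian_kernel[OF A, of v] v(3) by simp
    have "v $ i = 0" for i
    proof -
      have "(\<Sum>j\<in>UNIV. v $ j) = (\<Sum>j\<in>(UNIV::'n set). v $ i)"
        by (intro sum.cong refl eq)
      then show ?thesis
        using v(1) by (simp add: S_def)
    qed
    then show False
      using \<open>v \<noteq> 0\<close> by (simp add: vec_eq_iff)
  qed
  let ?E = "eigenvalues ?L - {0}"
  have fin: "finite ?E"
    using finite_eigenvalues_symmetric[OF sym] by simp
  have \<mu>: "\<mu> \<in> ?E"
    using v \<open>v \<noteq> 0\<close> \<open>\<mu> \<noteq> 0\<close> by (auto simp: eigenvalues_def scalar_mult_eq_scaleR)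
  then have le: "\<kappa> \<le> \<mu>"
    unfolding \<kappa>_def min_nonzero_eigenvalue_def using fin by (intro Min_le)
  have "\<kappa> \<in> ?E"
    unfolding \<kappa>_def min_nonzero_eigenvalue_def using fin \<mu> by (intro Min_in) auto
  then obtain u where u: "u \<noteq> 0" "?L *v u = \<kappa> *\<^sub>R u" "\<kappa> \<noteq> 0"
    by (auto simp: eigenvalues_def scalar_mult_eq_scaleR)
  have "0 \<le> \<kappa> * (u \<bullet> u)"
    using laplacian_nonneg[OF A(1), of u] u(2) by simp
  then show "0 < \<kappa>"
    using u by (metis inner_gt_zero_iff less_eq_real_def mult_less_0_iff not_less)
  show "\<kappa> * (norm x)\<^sup>2 \<le> x \<bullet> (?L *v x)" if "(\<Sum>i\<in>UNIV. x $ i) = 0"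
  proof -
    have "\<kappa> * (norm x)\<^sup>2 \<le> \<mu> * (norm x)\<^sup>2"
      using le by (intro mult_right_mono) auto
    with min[of x] that show ?thesis
      by (simp add: S_def)
  qed
  show "\<kappa> \<le> spectral_radius ?L"
    using quadratic_form_le_spectral_radius[OF sym, of v] v le by (simp add: dot_square_norm)
qed

section \<open>Consensus and disagreement of stacked vectors\<close>

text \<open>The action of \<open>B \<otimes> I\<close> on stacked vectors.\<close>

definition kron :: "real ^ 'n ^ 'n \<Rightarrow> 'a::real_vector ^ 'n \<Rightarrow> 'a ^ 'n::finite" where
  "kron B x = (\<chi> i. \<Sum>j\<in>UNIV. B $ i $ j *\<^sub>R x $ j)"

text \<open>The vector of the \<open>c\<close>-th coordinates of all agents. The matrix \<open>B \<otimes> I\<close> acts on each layer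
  as \<open>B\<close>, which transfers the bounds on quadratic forms of \<open>B\<close> to stacked vectors.\<close>

definition layer :: "'d \<Rightarrow> real ^ 'd ^ 'n \<Rightarrow> real ^ 'n::finite" where
  "layer c x = (\<chi> i. x $ i $ c)"

text \<open>The orthogonal complement of the consensus vectors.\<close>

definition disagreement :: "('a::real_vector ^ 'n::finite) set" where
  "disagreement = {x. (\<Sum>i\<in>UNIV. x $ i) = 0}"

lemma linear_kron: "linear (kron B)"
  by (rule linearI) (simp_all add: kron_def vec_eq_iff scaleR_add_right sum.distrib scaleR_sum_right mult.commute)

lemma inner_layers: "x \<bullet> y = (\<Sum>c\<in>UNIV. layer c x \<bullet> layer c y)"
proof -
  have "x \<bullet> y = (\<Sum>i\<in>UNIV. \<Sum>c\<in>UNIV. x $ i $ c * y $ i $ c)"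
    by (simp add: inner_vec_def)
  also have "\<dots> = (\<Sum>c\<in>UNIV. \<Sum>i\<in>UNIV. x $ i $ c * y $ i $ c)"
    by (rule sum.swap)
  finally show ?thesis
    by (simp add: inner_vec_def layer_def)
qed

lemma norm_layers: "(norm x)\<^sup>2 = (\<Sum>c\<in>UNIV. (norm (layer c x))\<^sup>2)"
  by (simp add: power2_norm_eq_inner inner_layers[of x])

lemma layer_kron: "layer c (kron B x) = B *v layer c x"
  by (simp add: layer_def kron_def matrix_vector_mult_def vec_eq_iff)

lemma kron_quadratic_form: "x \<bullet> kron B x = (\<Sum>c\<in>UNIV. layer c x \<bullet> (B *v layer c x))"
  by (simp add: inner_layers layer_kron)

lemma kron_self_adjoint:
  fixes x y :: "real ^ 'd ^ 'n"
  assumes "transpose B = B"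
  shows "kron B x \<bullet> y = x \<bullet> kron B y"
proof -
  have "(B *v u) \<bullet> v = u \<bullet> (B *v v)" for u v
    by (metis dot_lmul_matrix assms transpose_matrix_vector)
  then show ?thesis
    by (simp add: inner_layers layer_kron)
qed

lemma subspace_disagreement: "subspace disagreement"
  by (auto simp: disagreement_def subspace_def sum.distrib simp flip: scaleR_sum_right)

lemma inner_consensus: "vec a \<bullet> x = a \<bullet> (\<Sum>i\<in>UNIV. x $ i)"
  by (simp add: inner_vec_def[of "vec a"] inner_sum_right)

lemma inner_consensus_disagreement: "x \<in> disagreement \<Longrightarrow> vec a \<bullet> x = 0"
  by (simp add: inner_consensus disagreement_def)

lemma norm_consensus:
  "(norm (vec a :: 'a::real_inner ^ 'n::finite))\<^sup>2 = real CARD('n) * (norm a)\<^sup>2"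
  by (simp add: power2_norm_eq_inner inner_vec_def[of "vec a"])

lemma linear_vec: "linear (vec :: 'a::real_vector \<Rightarrow> 'a ^ 'n::finite)"
  by (rule linearI) (simp_all add: vec_eq_iff)

lemma kron_laplacian_consensus: "kron (laplacian A) (vec a) = 0"
  by (simp add: kron_def vec_eq_iff laplacian_row_sum flip: scaleR_sum_left)

lemma kron_laplacian_disagreement:
  assumes "weighted_undirected_graph A"
  shows "kron (laplacian A) x \<in> disagreement"
proof -
  have "(\<Sum>i\<in>UNIV. laplacian A $ i $ j) = 0" for j
    using laplacian_row_sum[of A j] arg_cong[OF laplacian_symmetric[OF assms], of "\<lambda>B. B $ j"]
    by (simp add: transpose_def vec_eq_iff)
  then show ?thesis
    unfolding disagreement_def kron_def mem_Collect_eq vec_lambda_beta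
    by (subst sum.swap) (simp flip: scaleR_sum_left)
qed

lemma kron_laplacian_nonneg:
  fixes x :: "real ^ 'd ^ 'n"
  assumes "weighted_undirected_graph A"
  shows "0 \<le> x \<bullet> kron (laplacian A) x"
  unfolding kron_quadratic_form by (intro sum_nonneg laplacian_nonneg assms)

lemma kron_laplacian_le:
  fixes x :: "real ^ 'd ^ 'n"
  assumes "weighted_undirected_graph A"
  shows "x \<bullet> kron (laplacian A) x \<le> spectral_radius (laplacian A) * (norm x)\<^sup>2"
  unfolding kron_quadratic_form norm_layers sum_distrib_left
  by (intro sum_mono quadratic_form_le_spectral_radius laplacian_symmetric assms)

lemma kron_laplacian_ge:
  fixes A :: "real ^ 'n ^ 'n" and x :: "real ^ 'd ^ 'n"
  assumes "weighted_undirected_graph A" "graph_connected A" "2 \<le> CARD('n)"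
    and x: "x \<in> disagreement"
  shows "min_nonzero_eigenvalue (laplacian A) * (norm x)\<^sup>2 \<le> x \<bullet> kron (laplacian A) x"
proof -
  have "(\<Sum>i\<in>UNIV. layer c x $ i) = 0" for c
  proof -
    have "(\<Sum>i\<in>UNIV. layer c x $ i) = (\<Sum>i\<in>UNIV. x $ i) $ c"
      by (simp add: layer_def)
    also have "(\<Sum>i\<in>UNIV. x $ i) = 0"
      using x by (simp only: disagreement_def mem_Collect_eq)
    finally show ?thesis
      by simp
  qed
  then show ?thesis
    unfolding kron_quadratic_form norm_layers sum_distrib_left
    by (intro sum_mono min_nonzero_eigenvalue_laplacian assms)
qed

text \<open>Adding the sum of the components, as a consensus vector, to the Laplacian makes it injective,
  hence invertible, and keeps it self-adjoint. On disagreement vectors the inverse of this operator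
  inverts the Laplacian itself, because the added summand vanishes there.\<close>

lemma laplacian_pseudoinverse:
  fixes A :: "real ^ 'n ^ 'n"
  assumes A: "weighted_undirected_graph A" "graph_connected A" "2 \<le> CARD('n)"
  defines "\<kappa> \<equiv> min_nonzero_eigenvalue (laplacian A)"
  obtains T :: "real ^ 'd ^ 'n \<Rightarrow> real ^ 'd ^ 'n" where
    "linear T" "\<And>x y. T x \<bullet> y = x \<bullet> T y"
    "\<And>w. w \<in> disagreement \<Longrightarrow> kron (laplacian A) (T w) = w"
    "\<And>w. w \<in> disagreement \<Longrightarrow> w \<bullet> T w \<le> (norm w)\<^sup>2 / \<kappa>"
proof -
  let ?L = "kron (laplacian A) :: real ^ 'd ^ 'n \<Rightarrow> real ^ 'd ^ 'n"
  define P :: "real ^ 'd ^ 'n \<Rightarrow> real ^ 'd ^ 'n" where "P x = ?L x + vec (\<Sum>i\<in>UNIV. x $ i)" for x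
  have \<kappa>: "0 < \<kappa>"
    unfolding \<kappa>_def by (rule min_nonzero_eigenvalue_laplacian[OF A])
  have lin: "linear P"
    unfolding P_def
    by (intro linear_compose_add linear_kron linear_compose[OF _ linear_vec, unfolded o_def]
        linear_compose_sum ballI bounded_linear.linear[OF bounded_linear_vec_nth])
  have self: "P x \<bullet> y = x \<bullet> P y" for x y
  proof -
    have P: "P u \<bullet> v = ?L u \<bullet> v + (\<Sum>i\<in>UNIV. u $ i) \<bullet> (\<Sum>i\<in>UNIV. v $ i)" for u v
      unfolding P_def inner_add_left inner_consensus ..
    have "?L x \<bullet> y = ?L y \<bullet> x"
      using kron_self_adjoint[OF laplacian_symmetric[OF A(1)], of x y] by (simp only: inner_commute)
    then have "P x \<bullet> y = P y \<bullet> x"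
      unfolding P by (simp only: inner_commute)
    then show ?thesis
      by (simp only: inner_commute)
  qed
  have sum_zero: "x \<in> disagreement" if "P x \<in> disagreement" for x
  proof -
    have "vec (\<Sum>i\<in>UNIV. x $ i) \<in> (disagreement :: (real ^ 'd ^ 'n) set)"
      using subspace_diff[OF subspace_disagreement that kron_laplacian_disagreement[OF A(1), of x]]
      by (simp add: P_def)
    then show ?thesis
      by (simp add: disagreement_def sum_constant_scaleR del: sum_constant)
  qed
  have kron: "?L x = P x" if "P x \<in> disagreement" for x
    using sum_zero[OF that] by (simp add: P_def disagreement_def vec_eq_iff)
  have "x = 0" if "P x = 0" for x
  proof -
    have dis: "P x \<in> disagreement"
      using that by (simp add: disagreement_def)
    have "\<kappa> * (norm x)\<^sup>2 \<le> x \<bullet> ?L x"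
      unfolding \<kappa>_def by (rule kron_laplacian_ge[OF A sum_zero[OF dis]])
    then have "\<kappa> * (norm x)\<^sup>2 \<le> 0"
      using kron[OF dis] that by simp
    then show ?thesis
      using \<kappa> by (simp add: mult_le_0_iff)
  qed
  then have "inj P"
    by (auto simp add: linear_injective_0[OF lin])
  define T where "T = inv P"
  have T: "linear T" "\<And>x. T (P x) = x" "\<And>x. P (T x) = x"
    unfolding T_def using \<open>inj P\<close> linear_inj_imp_surj[OF lin \<open>inj P\<close>]
    by (auto simp: inj_linear_imp_inv_linear[OF lin] surj_f_inv_f)
  show ?thesis
  proof
    show "linear T" by fact
    show "T x \<bullet> y = x \<bullet> T y" for x y
      using self[of "T x" "T y"] by (simp add: T)
    fix w :: "real ^ 'd ^ 'n" assume w: "w \<in> disagreement"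
    show LT: "?L (T w) = w"
      using kron[of "T w"] w by (simp add: T)
    have "\<kappa> * (norm (T w))\<^sup>2 \<le> T w \<bullet> ?L (T w)"
      unfolding \<kappa>_def using w by (intro kron_laplacian_ge[OF A] sum_zero[of "T w"]) (simp add: T)
    also have "\<dots> \<le> norm (T w) * norm w"
      unfolding LT by (rule norm_cauchy_schwarz)
    finally have "norm (T w) * (\<kappa> * norm (T w)) \<le> norm (T w) * norm w"
      by (simp add: power2_eq_square ac_simps)
    then have "\<kappa> * norm (T w) \<le> norm w"
      by (cases "T w = 0") auto
    then have Tw: "norm (T w) \<le> norm w / \<kappa>"
      using \<kappa> by (simp add: field_simps)
    have "w \<bullet> T w \<le> norm w * norm (T w)"
      by (rule norm_cauchy_schwarz)
    also have "\<dots> \<le> norm w * (norm w / \<kappa>)"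
      by (intro mult_left_mono Tw) simp
    finally show "w \<bullet> T w \<le> (norm w)\<^sup>2 / \<kappa>"
      by (simp add: power2_eq_square)
  qed
qed

definition average :: "'a::real_vector ^ 'n \<Rightarrow> 'a" where
  "average x = (1 / real CARD('n)) *\<^sub>R (\<Sum>i\<in>UNIV. x $ i)"

lemma disagreement_average: "x - vec (average x) \<in> disagreement"
  for x :: "'a::real_vector ^ 'n::finite"
  by (simp add: disagreement_def average_def sum_subtractf sum_constant_scaleR del: sum_constant)

text \<open>Pythagoras: the difference of a stacked vector and its average is orthogonal to consensus.
  So the projection onto a set of consensus vectors is the projection of the average.\<close>

lemma norm_diff_consensus:
  fixes x :: "'a::real_inner ^ 'n::finite"
  shows "(norm (x - vec y))\<^sup>2
    = (norm (x - vec (average x)))\<^sup>2 + real CARD('n) * (norm (average x - y))\<^sup>2"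
proof -
  have "x - vec y = (x - vec (average x)) + vec (average x - y)"
    by (simp add: vec_eq_iff)
  also have "(norm \<dots>)\<^sup>2 = (norm (x - vec (average x)))\<^sup>2 + (norm (vec (average x - y) :: 'a ^ 'n))\<^sup>2"
    using inner_consensus_disagreement[OF disagreement_average[of x], of "average x - y"]
    by (intro norm_add_Pythagorean) (simp add: orthogonal_def inner_commute)
  finally show ?thesis
    by (simp add: norm_consensus)
qed

lemma closest_consensus_le:
  fixes x :: "'a::euclidean_space ^ 'n::finite"
  assumes "closed X" "y \<in> X"
  shows "norm (x - vec (closest_point X (average x))) \<le> norm (x - vec y)"
proof (rule power2_le_imp_le)
  have "norm (average x - closest_point X (average x)) \<le> norm (average x - y)"
    using closest_point_le[OF assms, of "average x"] by (simp add: dist_norm)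
  then show "(norm (x - vec (closest_point X (average x))))\<^sup>2 \<le> (norm (x - vec y))\<^sup>2"
    unfolding norm_diff_consensus[of x "closest_point _ _"] norm_diff_consensus[of x y]
    by (intro add_left_mono mult_left_mono power_mono) auto
qed simp

lemma closest_point_consensus:
  fixes x :: "'a::euclidean_space ^ 'n::finite"
  assumes X: "convex X" "closed X" "X \<noteq> {}"
  shows "closest_point (vec ` X) x = vec (closest_point X (average x))"
proof (rule closest_point_unique[symmetric])
  show "convex ((vec :: 'a \<Rightarrow> 'a ^ 'n) ` X)"
    by (rule convex_linear_image[OF linear_vec X(1)])
  show "closed ((vec :: 'a \<Rightarrow> 'a ^ 'n) ` X)"
    by (intro closed_injective_linear_image X linear_vec injI) (simp add: vec_eq_iff)
  show "vec (closest_point X (average x)) \<in> vec ` X"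
    using closest_point_in_set[OF X(2,3)] by blast
  show "\<forall>z\<in>vec ` X. dist x (vec (closest_point X (average x))) \<le> dist x z"
    using closest_consensus_le[OF X(2)] by (auto simp: dist_norm)
qed

lemma lipschitz_stacked:
  fixes g :: "'n::finite \<Rightarrow> 'a::real_inner \<Rightarrow> 'a"
  assumes lip: "\<And>i y z. norm (g i y - g i z) \<le> K * norm (y - z)" and K: "0 \<le> K"
  shows "norm ((\<chi> i. g i (x $ i)) - (\<chi> i. g i (y $ i))) \<le> K * norm (x - y)"
proof (rule power2_le_imp_le)
  have norm_sq: "(norm (u :: 'a ^ 'n))\<^sup>2 = (\<Sum>i\<in>UNIV. (norm (u $ i))\<^sup>2)" for u
    by (simp add: power2_norm_eq_inner inner_vec_def[of u])
  have "(norm ((\<chi> i. g i (x $ i)) - (\<chi> i. g i (y $ i))))\<^sup>2 \<le> (\<Sum>i\<in>UNIV. (K * norm (x $ i - y $ i))\<^sup>2)"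
    unfolding norm_sq by (intro sum_mono power_mono) (auto simp: lip)
  also have "\<dots> = (K * norm (x - y))\<^sup>2"
    by (simp add: power_mult_distrib norm_sq[of "x - y"] sum_distrib_left)
  finally show "(norm ((\<chi> i. g i (x $ i)) - (\<chi> i. g i (y $ i))))\<^sup>2 \<le> (K * norm (x - y))\<^sup>2" .
qed (use K in simp)

text \<open>Decompose \<open>x - vec y\<close> into the disagreement \<open>d\<close> of \<open>x\<close> and the consensus vector \<open>e\<close> of
  the deviation of the average. The Laplacian is coercive on \<open>d\<close> and the secant inequality is
  coercive on \<open>e\<close>. The Lipschitz bound on the remaining products costs \<open>K (norm d)\<^sup>2\<close> and
  \<open>2 K norm d norm e\<close>; Young's inequality charges half of the coercivity on \<open>e\<close> for the latter
  and puts the rest on \<open>d\<close>. This gives exactly the two entries of the minimum.\<close>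

lemma restricted_strong_monotonicity:
  fixes g :: "'n::finite \<Rightarrow> 'a::real_inner \<Rightarrow> 'a" and \<Lambda> :: "'a ^ 'n \<Rightarrow> 'a ^ 'n"
  assumes \<Lambda>: "linear \<Lambda>" "\<And>x y. \<Lambda> x \<bullet> y = x \<bullet> \<Lambda> y" "\<And>a. \<Lambda> (vec a) = 0"
    and gap: "\<And>d. d \<in> disagreement \<Longrightarrow> \<kappa> * (norm d)\<^sup>2 \<le> d \<bullet> \<Lambda> d"
    and lip: "\<And>i y z. norm (g i y - g i z) \<le> K * norm (y - z)" and K: "0 \<le> K"
    and \<nu>: "0 < \<nu>" and \<alpha>: "0 \<le> \<alpha>"
    and rsi: "\<nu> * (norm (average x - y))\<^sup>2
      \<le> ((\<Sum>i\<in>UNIV. g i (average x)) - (\<Sum>i\<in>UNIV. g i y)) \<bullet> (average x - y)"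
  defines "N \<equiv> real CARD('n)"
  shows "min (\<nu> / (2 * N)) (\<alpha> * \<kappa> - (2 * N * K\<^sup>2 + \<nu> * K) / \<nu>) * (norm (x - vec y))\<^sup>2
    \<le> (x - vec y) \<bullet> (\<alpha> *\<^sub>R \<Lambda> (x - vec y) + ((\<chi> i. g i (x $ i)) - (\<chi> i. g i y)))"
proof -
  define G where "G u = (\<chi> i. g i (u $ i))" for u :: "'a ^ 'n"
  define m where "m = average x"
  define d where "d = x - vec m"
  define e where "e = (vec (m - y) :: 'a ^ 'n)"
  have N: "0 < N"
    by (simp add: N_def)
  have d: "d \<in> disagreement"
    unfolding d_def m_def by (rule disagreement_average)
  have z: "x - vec y = d + e"
    by (simp add: d_def e_def vec_eq_iff)
  have norm_z: "(norm (d + e))\<^sup>2 = (norm d)\<^sup>2 + (norm e)\<^sup>2"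
    using inner_consensus_disagreement[OF d, of "m - y"]
    by (intro norm_add_Pythagorean) (simp add: orthogonal_def inner_commute e_def)
  have "(d + e) \<bullet> \<Lambda> (d + e) = d \<bullet> \<Lambda> d"
    using \<Lambda>(2)[of e d] by (simp add: linear_add[OF \<Lambda>(1)] inner_simps \<Lambda>(3) e_def)
  then have quad: "\<alpha> * \<kappa> * (norm d)\<^sup>2 \<le> \<alpha> * ((d + e) \<bullet> \<Lambda> (d + e))"
    using mult_left_mono[OF gap[OF d] \<alpha>] by (simp add: mult.assoc)
  have lip_G: "norm (G u - G v) \<le> K * norm (u - v)" for u v
    unfolding G_def by (rule lipschitz_stacked[OF lip K])
  have cs: "- (K * (norm u * norm (v - v'))) \<le> u \<bullet> (G v - G v')" for u v v'
  proof -
    have "\<bar>u \<bullet> (G v - G v')\<bar> \<le> norm u * norm (G v - G v')"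
      by (rule Cauchy_Schwarz_ineq2)
    also have "\<dots> \<le> norm u * (K * norm (v - v'))"
      by (intro mult_left_mono lip_G) simp
    finally show ?thesis
      by (simp add: ac_simps)
  qed
  have "vec m - vec y = e"
    by (simp add: e_def vec_eq_iff)
  then have terms: "- (K * (norm d * norm d)) \<le> d \<bullet> (G x - G (vec m))"
      "- (K * (norm d * norm e)) \<le> d \<bullet> (G (vec m) - G (vec y))"
      "- (K * (norm e * norm d)) \<le> e \<bullet> (G x - G (vec m))"
    using cs[of d x "vec m"] cs[of d "vec m" "vec y"] cs[of e x "vec m"] by (simp_all add: d_def)
  have "\<nu> / N * (norm e)\<^sup>2 = \<nu> * (norm (m - y))\<^sup>2"
    unfolding e_def norm_consensus using N by (simp add: N_def)
  also have "\<dots> \<le> e \<bullet> (G (vec m) - G (vec y))"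
    using rsi by (simp add: e_def inner_consensus G_def m_def sum_subtractf inner_commute)
  finally have avg: "\<nu> / N * (norm e)\<^sup>2 \<le> e \<bullet> (G (vec m) - G (vec y))" .
  define r where "r = \<nu> / (2 * N)"
  define q where "q = 2 * N * K\<^sup>2 / \<nu>"
  have coeffs: "\<nu> / N = 2 * r" "(2 * N * K\<^sup>2 + \<nu> * K) / \<nu> = q + K"
    using \<nu> by (simp_all add: r_def q_def add_divide_distrib)
  have young: "2 * (K * (norm d * norm e)) \<le> r * (norm e)\<^sup>2 + q * (norm d)\<^sup>2"
  proof -
    define t where "t = 2 * N * K / \<nu>"
    have t: "r * t = K" "K * t = q"
      using \<nu> N by (simp_all add: r_def t_def q_def power2_eq_square)
    have "0 \<le> r * (norm e - t * norm d)\<^sup>2"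
      using \<nu> N by (simp add: r_def)
    also have "\<dots> = r * (norm e)\<^sup>2 - 2 * ((r * t) * (norm d * norm e)) + (r * t) * t * (norm d)\<^sup>2"
      by (simp add: power2_eq_square algebra_simps)
    finally show ?thesis
      by (simp add: t)
  qed
  have "min r (\<alpha> * \<kappa> - (q + K)) * ((norm d)\<^sup>2 + (norm e)\<^sup>2)
      \<le> (\<alpha> * \<kappa> - (q + K)) * (norm d)\<^sup>2 + r * (norm e)\<^sup>2"
    unfolding distrib_left
    by (intro add_mono mult_right_mono min.cobounded1 min.cobounded2) auto
  also have "\<dots> = \<alpha> * \<kappa> * (norm d)\<^sup>2 - K * (norm d * norm d) + 2 * r * (norm e)\<^sup>2
      - (r * (norm e)\<^sup>2 + q * (norm d)\<^sup>2)"
    by (simp add: power2_eq_square algebra_simps)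
  also have "\<dots> \<le> \<alpha> * ((d + e) \<bullet> \<Lambda> (d + e)) + (d \<bullet> (G x - G (vec m)) + d \<bullet> (G (vec m) - G (vec y))
      + e \<bullet> (G x - G (vec m)) + e \<bullet> (G (vec m) - G (vec y)))"
    using quad terms avg young unfolding coeffs mult.commute[of "norm e" "norm d"] by linarith
  also have "\<dots> = (d + e) \<bullet> (\<alpha> *\<^sub>R \<Lambda> (d + e) + (G x - G (vec y)))"
    by (simp add: inner_simps)
  finally show ?thesis
    unfolding z norm_z coeffs(2) by (simp add: G_def r_def)
qed

section \<open>The Lyapunov function of the primal-dual dynamics\<close>

lemma inner_le_half_squares:
  fixes a b :: "'b::real_inner"
  shows "\<bar>a \<bullet> b\<bar> \<le> ((norm a)\<^sup>2 + (norm b)\<^sup>2) / 2"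
proof -
  have "\<bar>a \<bullet> b\<bar> \<le> norm a * norm b"
    by (rule Cauchy_Schwarz_ineq2)
  moreover have "2 * (norm a * norm b) \<le> (norm a)\<^sup>2 + (norm b)\<^sup>2"
    using sum_squares_bound[of "norm a" "norm b"] by simp
  ultimately show ?thesis
    by simp
qed

lemma norm_add_squared_le:
  "(norm (a + b))\<^sup>2 \<le> 2 * (norm a)\<^sup>2 + 2 * (norm b)\<^sup>2" for a b :: "'a::real_inner"
  using inner_le_half_squares[of a b]
  by (simp add: power2_norm_eq_inner inner_simps inner_commute)

text \<open>The algebraic core of the dynamics: \<open>\<Lambda>\<close> is the Laplacian of the network, \<open>S\<close> is the space of
  disagreement vectors, in which the dual error lives, \<open>T\<close> is an inverse of \<open>\<Lambda>\<close> on \<open>S\<close>, and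
  \<open>K\<close> is the Lipschitz constant of the gradients.\<close>

locale primal_dual =
  fixes \<Lambda> T :: "'a::euclidean_space \<Rightarrow> 'a" and S :: "'a set"
    and \<alpha> \<beta> \<rho> \<kappa> K \<nu>\<^sub>1 \<epsilon>\<^sub>1 \<epsilon>\<^sub>2 \<epsilon>\<^sub>3 :: real
  assumes linear_\<Lambda>: "linear \<Lambda>" and linear_T: "linear T"
    and self_adjoint_\<Lambda>: "\<Lambda> x \<bullet> y = x \<bullet> \<Lambda> y" and self_adjoint_T: "T x \<bullet> y = x \<bullet> T y"
    and subspace_S: "subspace S" and range_\<Lambda>: "\<Lambda> x \<in> S"
    and right_inverse: "w \<in> S \<Longrightarrow> \<Lambda> (T w) = w"
    and \<Lambda>_nonneg: "0 \<le> x \<bullet> \<Lambda> x" and \<Lambda>_le: "x \<bullet> \<Lambda> x \<le> \<rho> * (norm x)\<^sup>2"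
    and T_le: "w \<in> S \<Longrightarrow> w \<bullet> T w \<le> (norm w)\<^sup>2 / \<kappa>"
    and \<kappa>_pos: "0 < \<kappa>" and \<alpha>_pos: "0 < \<alpha>" and \<beta>_pos: "0 < \<beta>" and K_nonneg: "0 \<le> K"
    and \<nu>\<^sub>1_pos: "0 < \<nu>\<^sub>1" and \<nu>\<^sub>1_less: "\<nu>\<^sub>1 < \<alpha> * \<rho>"
    and \<epsilon>\<^sub>1_def: "\<epsilon>\<^sub>1 = max (1 / \<nu>\<^sub>1 * (K\<^sup>2 / (2 * \<beta>) + \<beta> * \<rho>)) (1 / 2)"
    and \<epsilon>\<^sub>2_def: "\<epsilon>\<^sub>2 = min (\<beta> / 2) (\<epsilon>\<^sub>1 * \<nu>\<^sub>1)"
    and \<epsilon>\<^sub>3_def: "\<epsilon>\<^sub>3 = max (\<epsilon>\<^sub>1 + 1 / 2) (\<epsilon>\<^sub>1 / \<kappa> + \<alpha> / (2 * \<beta>) + 1 / 2)"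
begin

definition lyapunov :: "'a \<Rightarrow> 'a \<Rightarrow> real" where
  "lyapunov z w = \<epsilon>\<^sub>1 * (z \<bullet> z) + \<epsilon>\<^sub>1 * (w \<bullet> T w) + z \<bullet> w + \<alpha> / (2 * \<beta>) * (w \<bullet> w)"

lemma \<rho>_pos: "0 < \<rho>"
  using \<nu>\<^sub>1_pos \<nu>\<^sub>1_less \<alpha>_pos by (metis less_trans zero_less_mult_pos)

lemma \<epsilon>\<^sub>1_pos: "0 < \<epsilon>\<^sub>1" and \<epsilon>\<^sub>2_pos: "0 < \<epsilon>\<^sub>2" and \<epsilon>\<^sub>3_pos: "0 < \<epsilon>\<^sub>3"
proof -
  show 1: "0 < \<epsilon>\<^sub>1"
    by (simp add: \<epsilon>\<^sub>1_def)
  then show "0 < \<epsilon>\<^sub>2" "0 < \<epsilon>\<^sub>3"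
    using \<beta>_pos \<nu>\<^sub>1_pos by (auto simp: \<epsilon>\<^sub>2_def \<epsilon>\<^sub>3_def less_max_iff_disj)
qed

lemma \<epsilon>\<^sub>1_times_\<nu>\<^sub>1: "K\<^sup>2 / (2 * \<beta>) + \<beta> * \<rho> \<le> \<epsilon>\<^sub>1 * \<nu>\<^sub>1"
proof -
  have "1 / \<nu>\<^sub>1 * (K\<^sup>2 / (2 * \<beta>) + \<beta> * \<rho>) \<le> \<epsilon>\<^sub>1"
    by (simp add: \<epsilon>\<^sub>1_def)
  then have "1 / \<nu>\<^sub>1 * (K\<^sup>2 / (2 * \<beta>) + \<beta> * \<rho>) * \<nu>\<^sub>1 \<le> \<epsilon>\<^sub>1 * \<nu>\<^sub>1"
    using \<nu>\<^sub>1_pos by (intro mult_right_mono) auto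
  then show ?thesis
    using \<nu>\<^sub>1_pos by simp
qed

lemma T_nonneg:
  assumes "w \<in> S" shows "0 \<le> w \<bullet> T w"
  using \<Lambda>_nonneg[of "T w"] by (simp add: right_inverse[OF assms] inner_commute)

text \<open>This is what makes the Lyapunov function positive definite. The term \<open>\<beta> * \<rho>\<close> in the definition
  of \<open>\<epsilon>\<^sub>1\<close> together with \<open>\<nu>\<^sub>1 < \<alpha> * \<rho>\<close> forces it.\<close>

lemma \<beta>_less: "\<beta> < \<epsilon>\<^sub>1 * \<alpha>"
proof -
  have "\<beta> * \<rho> \<le> \<epsilon>\<^sub>1 * \<nu>\<^sub>1"
    using \<epsilon>\<^sub>1_times_\<nu>\<^sub>1 \<beta>_pos by (smt (verit) divide_nonneg_pos zero_le_power2)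
  also have "\<dots> < \<epsilon>\<^sub>1 * (\<alpha> * \<rho>)"
    using \<nu>\<^sub>1_less \<epsilon>\<^sub>1_pos by simp
  finally show ?thesis
    using \<rho>_pos by simp
qed

lemma lyapunov_upper:
  assumes "w \<in> S"
  shows "lyapunov z w \<le> \<epsilon>\<^sub>3 * ((norm z)\<^sup>2 + (norm w)\<^sup>2)"
proof -
  have "lyapunov z w \<le> \<epsilon>\<^sub>1 * (norm z)\<^sup>2 + \<epsilon>\<^sub>1 * ((norm w)\<^sup>2 / \<kappa>)
      + ((norm z)\<^sup>2 + (norm w)\<^sup>2) / 2 + \<alpha> / (2 * \<beta>) * (norm w)\<^sup>2"
  proof -
    have "\<epsilon>\<^sub>1 * (w \<bullet> T w) \<le> \<epsilon>\<^sub>1 * ((norm w)\<^sup>2 / \<kappa>)"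
      using \<epsilon>\<^sub>1_pos by (intro mult_left_mono T_le assms) simp
    moreover have "z \<bullet> w \<le> ((norm z)\<^sup>2 + (norm w)\<^sup>2) / 2"
      using inner_le_half_squares[of z w] by linarith
    ultimately show ?thesis
      unfolding lyapunov_def power2_norm_eq_inner by linarith
  qed
  also have "\<dots> = (\<epsilon>\<^sub>1 + 1 / 2) * (norm z)\<^sup>2 + (\<epsilon>\<^sub>1 / \<kappa> + \<alpha> / (2 * \<beta>) + 1 / 2) * (norm w)\<^sup>2"
    by (simp add: algebra_simps add_divide_distrib)
  also have "\<dots> \<le> \<epsilon>\<^sub>3 * (norm z)\<^sup>2 + \<epsilon>\<^sub>3 * (norm w)\<^sup>2"
    by (intro add_mono mult_right_mono) (auto simp: \<epsilon>\<^sub>3_def)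
  finally show ?thesis
    by (simp add: algebra_simps)
qed

text \<open>Completing the square in \<open>z\<close> with half of the term \<open>\<epsilon>\<^sub>1 * (z \<bullet> z)\<close> absorbs the product
  \<open>z \<bullet> w\<close> and costs \<open>1 / (2 * \<epsilon>\<^sub>1)\<close> times the square of \<open>norm w\<close>. By \<open>\<beta>_less\<close> this is
  less than \<open>\<alpha> / (2 * \<beta>)\<close>, while the term with \<open>T\<close> is nonnegative.\<close>

lemma lyapunov_lower:
  obtains c where "0 < c" "\<And>z w. w \<in> S \<Longrightarrow> c * ((norm z)\<^sup>2 + (norm w)\<^sup>2) \<le> lyapunov z w"
proof
  define c where "c = min (\<epsilon>\<^sub>1 / 2) (\<alpha> / (2 * \<beta>) - 1 / (2 * \<epsilon>\<^sub>1))"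
  show "0 < c"
    using \<epsilon>\<^sub>1_pos \<beta>_less \<beta>_pos by (simp add: c_def field_simps)
  have c_le: "c \<le> \<epsilon>\<^sub>1 / 2" "c \<le> \<alpha> / (2 * \<beta>) - 1 / (2 * \<epsilon>\<^sub>1)"
    unfolding c_def by (rule min.cobounded1, rule min.cobounded2)
  fix z w assume w: "w \<in> S"
  have "0 \<le> \<epsilon>\<^sub>1 / 2 * (norm (z + (1 / \<epsilon>\<^sub>1) *\<^sub>R w))\<^sup>2"
    using \<epsilon>\<^sub>1_pos by simp
  also have "\<dots> = \<epsilon>\<^sub>1 / 2 * (norm z)\<^sup>2 + z \<bullet> w + 1 / (2 * \<epsilon>\<^sub>1) * (norm w)\<^sup>2"
    using \<epsilon>\<^sub>1_pos unfolding power2_norm_eq_inner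
    by (simp add: inner_simps inner_commute field_simps)
  finally have cross: "- (\<epsilon>\<^sub>1 / 2 * (norm z)\<^sup>2) - 1 / (2 * \<epsilon>\<^sub>1) * (norm w)\<^sup>2 \<le> z \<bullet> w"
    by simp
  have "c * ((norm z)\<^sup>2 + (norm w)\<^sup>2)
      \<le> \<epsilon>\<^sub>1 / 2 * (norm z)\<^sup>2 + (\<alpha> / (2 * \<beta>) - 1 / (2 * \<epsilon>\<^sub>1)) * (norm w)\<^sup>2"
    unfolding distrib_left by (intro add_mono mult_right_mono c_le) auto
  also have "\<dots> \<le> lyapunov z w"
    using cross mult_nonneg_nonneg[OF less_imp_le[OF \<epsilon>\<^sub>1_pos] T_nonneg[OF w]]
    by (simp add: lyapunov_def power2_norm_eq_inner left_diff_distrib)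
  finally show "c * ((norm z)\<^sup>2 + (norm w)\<^sup>2) \<le> lyapunov z w" .
qed

text \<open>This allows the projection point to change from one iterate to the next: with the new
  projection the norm of the primal error does not grow, and the inner product with \<open>w\<close> does not
  change, as two projection points differ by a consensus vector.\<close>

lemma lyapunov_mono:
  assumes "norm z \<le> norm u" "z \<bullet> w = u \<bullet> w"
  shows "lyapunov z w \<le> lyapunov u w"
proof -
  have "\<epsilon>\<^sub>1 * (z \<bullet> z) \<le> \<epsilon>\<^sub>1 * (u \<bullet> u)"
    using assms(1) \<epsilon>\<^sub>1_pos by (simp add: norm_le)
  then show ?thesis
    using assms(2) by (simp add: lyapunov_def)
qed

text \<open>The Lyapunov function is quadratic, so its change along a step is exactly \<open>h * D\<close> plus
  \<open>h\<^sup>2\<close> times its value at the increments. In the first-order term \<open>D\<close> the products \<open>z \<bullet> w\<close> cancel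
  because \<open>\<Lambda> (T w) = w\<close>, and the products \<open>w \<bullet> \<Lambda> z\<close> and \<open>w \<bullet> \<Lambda> e\<close> cancel by the choice of
  the coefficient \<open>\<alpha> / (2 * \<beta>)\<close>. The noise enters \<open>D\<close> linearly, with coefficients that depend on
  the current errors \<open>z\<close> and \<open>w\<close> only.\<close>

lemma lyapunov_decrease:
  assumes w: "w \<in> S" and mono: "\<nu>\<^sub>1 * (norm z)\<^sup>2 \<le> z \<bullet> (\<alpha> *\<^sub>R \<Lambda> z + G)"
    and G: "norm G \<le> K * norm z" and h: "0 \<le> h"
    and p: "p = - (\<alpha> *\<^sub>R \<Lambda> (z + e) + \<beta> *\<^sub>R w + G + \<zeta>)" and r: "r = \<beta> *\<^sub>R \<Lambda> (z + e)"
  shows "lyapunov (z + h *\<^sub>R p) (w + h *\<^sub>R r)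
    \<le> lyapunov z w - h * (\<epsilon>\<^sub>2 * ((norm z)\<^sup>2 + (norm w)\<^sup>2))
      + h * (((\<beta> - 2 * \<epsilon>\<^sub>1 * \<alpha>) *\<^sub>R \<Lambda> z + (2 * \<epsilon>\<^sub>1 * \<beta>) *\<^sub>R w) \<bullet> e
              - ((2 * \<epsilon>\<^sub>1) *\<^sub>R z + w) \<bullet> \<zeta>)
      + h\<^sup>2 * lyapunov p r"
proof -
  define D where "D = 2 * \<epsilon>\<^sub>1 * (z \<bullet> p) + 2 * \<epsilon>\<^sub>1 * (w \<bullet> T r) + z \<bullet> r + w \<bullet> p + \<alpha> / \<beta> * (w \<bullet> r)"
  define noise where "noise = ((\<beta> - 2 * \<epsilon>\<^sub>1 * \<alpha>) *\<^sub>R \<Lambda> z + (2 * \<epsilon>\<^sub>1 * \<beta>) *\<^sub>R w) \<bullet> e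
              - ((2 * \<epsilon>\<^sub>1) *\<^sub>R z + w) \<bullet> \<zeta>"
  have "r \<bullet> T w = w \<bullet> T r"
    using self_adjoint_T[of w r] by (simp add: inner_commute)
  then have expand: "lyapunov (z + h *\<^sub>R p) (w + h *\<^sub>R r) = lyapunov z w + h * D + h\<^sup>2 * lyapunov p r"
    using \<beta>_pos unfolding lyapunov_def D_def
    by (simp add: inner_simps linear_add[OF linear_T] linear_scale[OF linear_T] inner_commute
        power2_eq_square field_simps)
  have "w \<bullet> T r = \<beta> * (w \<bullet> z + w \<bullet> e)"
  proof -
    have "w \<bullet> T r = T w \<bullet> r"
      by (simp add: self_adjoint_T)
    also have "\<dots> = \<beta> * (\<Lambda> (T w) \<bullet> (z + e))"
      by (simp add: r self_adjoint_\<Lambda>)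
    finally show ?thesis
      by (simp add: right_inverse[OF w] inner_simps)
  qed
  moreover have "z \<bullet> \<Lambda> e = \<Lambda> z \<bullet> e"
    by (simp add: self_adjoint_\<Lambda>)
  ultimately have D: "D = noise - 2 * \<epsilon>\<^sub>1 * (z \<bullet> (\<alpha> *\<^sub>R \<Lambda> z + G)) + \<beta> * (z \<bullet> \<Lambda> z) - \<beta> * (norm w)\<^sup>2 - w \<bullet> G"
    using \<beta>_pos unfolding D_def noise_def p r power2_norm_eq_inner
    by (simp add: inner_simps linear_add[OF linear_\<Lambda>] inner_commute algebra_simps)
  have wG: "- (w \<bullet> G) \<le> \<beta> / 2 * (norm w)\<^sup>2 + K\<^sup>2 / (2 * \<beta>) * (norm z)\<^sup>2"
  proof -
    have "0 \<le> 1 / (2 * \<beta>) * (norm (\<beta> *\<^sub>R w + G))\<^sup>2"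
      using \<beta>_pos by simp
    also have "\<dots> = \<beta> / 2 * (norm w)\<^sup>2 + w \<bullet> G + 1 / (2 * \<beta>) * (norm G)\<^sup>2"
      using \<beta>_pos unfolding power2_norm_eq_inner
      by (simp add: inner_simps inner_commute field_simps)
    finally have "- (w \<bullet> G) \<le> \<beta> / 2 * (norm w)\<^sup>2 + 1 / (2 * \<beta>) * (norm G)\<^sup>2"
      by simp
    also have "1 / (2 * \<beta>) * (norm G)\<^sup>2 \<le> 1 / (2 * \<beta>) * (K * norm z)\<^sup>2"
      using \<beta>_pos by (intro mult_left_mono power_mono G) auto
    finally show ?thesis
      by (simp add: power_mult_distrib)
  qed
  have "\<beta> * (z \<bullet> \<Lambda> z) + K\<^sup>2 / (2 * \<beta>) * (norm z)\<^sup>2 \<le> (K\<^sup>2 / (2 * \<beta>) + \<beta> * \<rho>) * (norm z)\<^sup>2"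
    using mult_left_mono[OF \<Lambda>_le[of z] less_imp_le[OF \<beta>_pos]] by (simp add: algebra_simps)
  also have "\<dots> \<le> \<epsilon>\<^sub>1 * \<nu>\<^sub>1 * (norm z)\<^sup>2"
    by (intro mult_right_mono \<epsilon>\<^sub>1_times_\<nu>\<^sub>1) auto
  finally have "\<beta> * (z \<bullet> \<Lambda> z) + K\<^sup>2 / (2 * \<beta>) * (norm z)\<^sup>2 \<le> \<epsilon>\<^sub>1 * \<nu>\<^sub>1 * (norm z)\<^sup>2" .
  then have "D \<le> noise - 2 * \<epsilon>\<^sub>1 * (\<nu>\<^sub>1 * (norm z)\<^sup>2) + \<epsilon>\<^sub>1 * \<nu>\<^sub>1 * (norm z)\<^sup>2 - \<beta> / 2 * (norm w)\<^sup>2"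
  proof -
    have "2 * \<epsilon>\<^sub>1 * (\<nu>\<^sub>1 * (norm z)\<^sup>2) \<le> 2 * \<epsilon>\<^sub>1 * (z \<bullet> (\<alpha> *\<^sub>R \<Lambda> z + G))"
      using \<epsilon>\<^sub>1_pos by (intro mult_left_mono mono) simp
    moreover have "\<beta> / 2 * (norm w)\<^sup>2 = \<beta> * (norm w)\<^sup>2 / 2"
      by simp
    ultimately show ?thesis
      using wG \<open>\<beta> * (z \<bullet> \<Lambda> z) + K\<^sup>2 / (2 * \<beta>) * (norm z)\<^sup>2 \<le> \<epsilon>\<^sub>1 * \<nu>\<^sub>1 * (norm z)\<^sup>2\<close>
      unfolding D by linarith
  qed
  also have "\<dots> = noise - (\<epsilon>\<^sub>1 * \<nu>\<^sub>1 * (norm z)\<^sup>2 + \<beta> / 2 * (norm w)\<^sup>2)"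
    by simp
  also have "\<dots> \<le> noise - (\<epsilon>\<^sub>2 * (norm z)\<^sup>2 + \<epsilon>\<^sub>2 * (norm w)\<^sup>2)"
    by (intro diff_left_mono add_mono mult_right_mono) (auto simp: \<epsilon>\<^sub>2_def)
  finally have "h * D \<le> h * (noise - (\<epsilon>\<^sub>2 * (norm z)\<^sup>2 + \<epsilon>\<^sub>2 * (norm w)\<^sup>2))"
    using h by (rule mult_left_mono)
  then show ?thesis
    unfolding expand noise_def[symmetric] by (simp add: algebra_simps)
qed

lemma increments_bound:
  obtains C where "0 < C"
    "\<And>z w e \<zeta> G. norm G \<le> K * norm z \<Longrightarrow>
      (norm (\<alpha> *\<^sub>R \<Lambda> (z + e) + \<beta> *\<^sub>R w + G + \<zeta>))\<^sup>2 + (norm (\<beta> *\<^sub>R \<Lambda> (z + e)))\<^sup>2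
      \<le> C * (((norm z)\<^sup>2 + (norm w)\<^sup>2) + ((norm e)\<^sup>2 + (norm \<zeta>)\<^sup>2))"
proof -
  obtain B where B: "0 < B" "\<And>x. norm (\<Lambda> x) \<le> B * norm x"
    using linear_bounded_pos[OF linear_\<Lambda>] by blast
  define C where "C = \<alpha> * B + \<beta> * B + \<beta> + K + 1"
  have C: "0 < C"
    unfolding C_def using B \<alpha>_pos \<beta>_pos K_nonneg by (simp add: add_nonneg_pos)
  have sq: "(a + b + c + d)\<^sup>2 \<le> 4 * ((a\<^sup>2 + b\<^sup>2) + (c\<^sup>2 + d\<^sup>2))" for a b c d :: real
  proof -
    have "0 \<le> (a - b)\<^sup>2 + (a - c)\<^sup>2 + (a - d)\<^sup>2 + (b - c)\<^sup>2 + (b - d)\<^sup>2 + (c - d)\<^sup>2"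
      by simp
    then show ?thesis
      by (simp add: power2_eq_square algebra_simps)
  qed
  show ?thesis
  proof
    show "0 < 8 * C\<^sup>2"
      using C by simp
    fix z w e \<zeta> G :: 'a assume G: "norm G \<le> K * norm z"
    let ?s = "norm z + norm w + norm e + norm \<zeta>"
    have \<Lambda>: "norm (\<Lambda> (z + e)) \<le> B * (norm z + norm e)"
      using B(2)[of "z + e"] norm_triangle_ineq[of z e] B(1)
      by (smt (verit) mult_left_mono)
    have cs: "c * t \<le> c * ?s" if "0 \<le> c" "t \<in> {norm z + norm e, norm w, norm z, norm \<zeta>}" for c t
      using that by (intro mult_left_mono) auto
    have "norm (\<beta> *\<^sub>R \<Lambda> (z + e)) \<le> \<beta> * (B * (norm z + norm e))"
      using mult_left_mono[OF \<Lambda> less_imp_le[OF \<beta>_pos]] \<beta>_pos by (simp only: norm_scaleR)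
    also have "\<dots> \<le> (\<beta> * B) * ?s"
      using cs[of "\<beta> * B" "norm z + norm e"] B(1) \<beta>_pos by (simp add: mult.assoc)
    also have "\<dots> \<le> C * ?s"
      using \<alpha>_pos \<beta>_pos K_nonneg B(1) by (intro mult_right_mono) (auto simp: C_def)
    finally have r: "norm (\<beta> *\<^sub>R \<Lambda> (z + e)) \<le> C * ?s" .
    have "norm (\<alpha> *\<^sub>R \<Lambda> (z + e) + \<beta> *\<^sub>R w + G + \<zeta>)
        \<le> norm (\<alpha> *\<^sub>R \<Lambda> (z + e)) + norm (\<beta> *\<^sub>R w) + norm G + norm \<zeta>"
      by (intro norm_triangle_le add_mono order_refl)
    also have "\<dots> \<le> \<alpha> * (B * (norm z + norm e)) + \<beta> * norm w + K * norm z + 1 * norm \<zeta>"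
    proof -
      have "norm (\<alpha> *\<^sub>R \<Lambda> (z + e)) \<le> \<alpha> * (B * (norm z + norm e))"
        using mult_left_mono[OF \<Lambda> less_imp_le[OF \<alpha>_pos]] \<alpha>_pos by (simp only: norm_scaleR)
      then show ?thesis
        using \<beta>_pos G by simp
    qed
    also have "\<dots> \<le> (\<alpha> * B) * ?s + \<beta> * ?s + K * ?s + 1 * ?s"
      unfolding mult.assoc[symmetric]
      using \<alpha>_pos \<beta>_pos K_nonneg B(1) by (intro add_mono cs) auto
    also have "\<dots> \<le> C * ?s"
      using \<beta>_pos B(1) unfolding distrib_right[symmetric] by (intro mult_right_mono) (auto simp: C_def)
    finally have p: "norm (\<alpha> *\<^sub>R \<Lambda> (z + e) + \<beta> *\<^sub>R w + G + \<zeta>) \<le> C * ?s" .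
    have "(norm (\<alpha> *\<^sub>R \<Lambda> (z + e) + \<beta> *\<^sub>R w + G + \<zeta>))\<^sup>2 + (norm (\<beta> *\<^sub>R \<Lambda> (z + e)))\<^sup>2
        \<le> (C * ?s)\<^sup>2 + (C * ?s)\<^sup>2"
      by (intro add_mono power_mono p r norm_ge_zero)
    also have "\<dots> = 2 * C\<^sup>2 * ?s\<^sup>2"
      by (simp add: power_mult_distrib)
    also have "\<dots> \<le> 2 * C\<^sup>2 * (4 * (((norm z)\<^sup>2 + (norm w)\<^sup>2) + ((norm e)\<^sup>2 + (norm \<zeta>)\<^sup>2)))"
      by (intro mult_left_mono sq) auto
    also have "\<dots> = 8 * C\<^sup>2 * (((norm z)\<^sup>2 + (norm w)\<^sup>2) + ((norm e)\<^sup>2 + (norm \<zeta>)\<^sup>2))"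
      by (simp add: algebra_simps)
    finally show "(norm (\<alpha> *\<^sub>R \<Lambda> (z + e) + \<beta> *\<^sub>R w + G + \<zeta>))\<^sup>2 + (norm (\<beta> *\<^sub>R \<Lambda> (z + e)))\<^sup>2
        \<le> 8 * C\<^sup>2 * (((norm z)\<^sup>2 + (norm w)\<^sup>2) + ((norm e)\<^sup>2 + (norm \<zeta>)\<^sup>2))" .
  qed
qed

end

section \<open>A recursion of Chung's type\<close>

text \<open>As soon as \<open>k\<close> is so large that the summand with \<open>a\<close> costs at most \<open>c - 2\<close>, the leading
  factor is at most \<open>1 - 2 / (k + 1)\<close>, and \<open>C / k\<close> is then a supersolution for every \<open>C \<ge> b\<close>.\<close>

lemma decay_rate_inverse:
  fixes u :: "nat \<Rightarrow> real"
  assumes nonneg: "\<And>k. 0 \<le> u k" and c: "2 < c"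
    and step: "\<And>k. u (Suc k) \<le> (1 - c / (real k + 1) + a / (real k + 1)\<^sup>2) * u k + b / (real k + 1)\<^sup>2"
  obtains C where "0 < C" "\<forall>\<^sub>F k in sequentially. u k \<le> C / real k"
proof -
  obtain N :: nat where N: "a / (c - 2) \<le> real N" "1 \<le> N"
    using real_arch_simple[of "max 1 (a / (c - 2))"] by (auto simp: max_def split: if_splits)
  define C where "C = max 1 (max b (real N * u N))"
  have "u k \<le> C / real k" if "N \<le> k" for k
    using that
  proof (induction k rule: dec_induct)
    case base
    have "real N * u N \<le> C"
      by (simp add: C_def)
    then show ?case
      using N by (simp add: field_simps)
  next
    case (step k)
    define t where "t = real k + 1"
    have t: "2 \<le> t"
      using N(2) step(1) by (simp add: t_def)
    have "a / (c - 2) \<le> t"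
      using N(1) step(1) by (simp add: t_def)
    then have "a \<le> (c - 2) * t"
      using c by (simp add: field_simps)
    then have "(a + 2 * t) * t \<le> (c * t) * t"
      using t by (intro mult_right_mono) (auto simp: algebra_simps)
    then have "- c / t + a / t\<^sup>2 \<le> - 2 / t"
      using t by (simp add: field_simps power2_eq_square)
    then have "1 - c / t + a / t\<^sup>2 \<le> 1 - 2 / t"
      by simp
    then have "(1 - c / t + a / t\<^sup>2) * u k \<le> (1 - 2 / t) * u k"
      by (rule mult_right_mono) (rule nonneg)
    also have "\<dots> \<le> (1 - 2 / t) * (C / real k)"
      using t step(3) by (intro mult_left_mono) auto
    finally have "u (Suc k) \<le> (1 - 2 / t) * (C / (t - 1)) + b / t\<^sup>2"
      using assms(3)[of k] by (simp add: t_def)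
    also have "\<dots> \<le> (1 - 2 / t) * (C / (t - 1)) + C / t\<^sup>2"
      by (intro add_left_mono divide_right_mono) (auto simp: C_def)
    also have "\<dots> \<le> C / t"
    proof -
      have "(1 - 2 / t) * (C / (t - 1)) + C / t\<^sup>2 = C / t - C / (t\<^sup>2 * (t - 1))"
        using t by (simp add: divide_simps power2_eq_square) (simp add: algebra_simps)
      moreover have "0 \<le> C / (t\<^sup>2 * (t - 1))"
        using t by (simp add: C_def)
      ultimately show ?thesis
        by simp
    qed
    finally show ?case
      by (simp add: t_def add.commute)
  qed
  then have "\<forall>\<^sub>F k in sequentially. u k \<le> C / real k"
    by (auto simp: eventually_sequentially)
  moreover have "0 < C"
    by (simp add: C_def)
  ultimately show ?thesis
    by (rule that[rotated])
qed

section \<open>Noise with vanishing conditional mean\<close>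

text \<open>The product is integrable by the Cauchy-Schwarz inequality, and a factor that is measurable
  with respect to \<open>F\<close> can be taken out of the conditional expectation, one coordinate at a time.\<close>

lemma inner_noise_expectation:
  fixes Y e :: "'w \<Rightarrow> real ^ 'd ^ 'n::finite"
  assumes "prob_space M" and sub: "subalgebra M F"
    and Y [measurable]: "Y \<in> borel_measurable F" and e [measurable]: "e \<in> borel_measurable M"
    and Y_sq: "integrable M (\<lambda>\<omega>. (norm (Y \<omega>))\<^sup>2)" and e_sq: "integrable M (\<lambda>\<omega>. (norm (e \<omega>))\<^sup>2)"
    and zero: "\<And>i. AE \<omega> in M. vec_cond_exp M F (\<lambda>\<omega>. e \<omega> $ i) \<omega> = 0"
  shows "integrable M (\<lambda>\<omega>. Y \<omega> \<bullet> e \<omega>)" and "(\<integral>\<omega>. Y \<omega> \<bullet> e \<omega> \<partial>M) = 0"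
proof -
  interpret prob_space M by fact
  interpret finite_measure_subalgebra M F
    by standard (rule sub)
  have comp: "(\<lambda>v. v $ i $ c) \<in> borel_measurable borel" for i c
    by (intro borel_measurable_continuous_onI continuous_intros)
  have Yc [measurable]: "(\<lambda>\<omega>. Y \<omega> $ i $ c) \<in> borel_measurable F" for i c
    by (rule measurable_compose[OF Y comp])
  have Yc' [measurable]: "(\<lambda>\<omega>. Y \<omega> $ i $ c) \<in> borel_measurable M" for i c
    by (rule measurable_from_subalg[OF sub Yc])
  have ec [measurable]: "(\<lambda>\<omega>. e \<omega> $ i $ c) \<in> borel_measurable M" for i c
    by (rule measurable_compose[OF e comp])
  have comp_le: "\<bar>v $ i $ c\<bar> \<le> norm v" for v :: "real ^ 'd ^ 'n" and i c
    using component_le_norm_cart[of "v $ i" c] Finite_Cartesian_Product.norm_nth_le[of v i] by linarith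
  have int: "integrable M (\<lambda>\<omega>. Y \<omega> $ i $ c * e \<omega> $ i $ c)" for i c
  proof (rule Bochner_Integration.integrable_bound[where f = "\<lambda>\<omega>. (norm (Y \<omega>))\<^sup>2 + (norm (e \<omega>))\<^sup>2"])
    show "integrable M (\<lambda>\<omega>. (norm (Y \<omega>))\<^sup>2 + (norm (e \<omega>))\<^sup>2)"
      using Y_sq e_sq by simp
    show "AE \<omega> in M. norm (Y \<omega> $ i $ c * e \<omega> $ i $ c) \<le> norm ((norm (Y \<omega>))\<^sup>2 + (norm (e \<omega>))\<^sup>2)"
    proof (intro AE_I2)
      fix \<omega>
      have "\<bar>Y \<omega> $ i $ c * e \<omega> $ i $ c\<bar> \<le> norm (Y \<omega>) * norm (e \<omega>)"
        unfolding abs_mult by (intro mult_mono comp_le) auto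
      also have "\<dots> \<le> (norm (Y \<omega>))\<^sup>2 + (norm (e \<omega>))\<^sup>2"
        using sum_squares_bound[of "norm (Y \<omega>)" "norm (e \<omega>)"]
          mult_nonneg_nonneg[OF norm_ge_zero[of "Y \<omega>"] norm_ge_zero[of "e \<omega>"]] by linarith
      finally show "norm (Y \<omega> $ i $ c * e \<omega> $ i $ c) \<le> norm ((norm (Y \<omega>))\<^sup>2 + (norm (e \<omega>))\<^sup>2)"
        by simp
    qed
  qed simp
  have "(\<integral>\<omega>. Y \<omega> $ i $ c * e \<omega> $ i $ c \<partial>M) = 0" for i c
  proof -
    have "AE \<omega> in M. Y \<omega> $ i $ c * real_cond_exp M F (\<lambda>\<omega>. e \<omega> $ i $ c) \<omega> = 0"
      using zero[of i] by eventually_elim (simp add: vec_cond_exp_def vec_eq_iff)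
    then have "(\<integral>\<omega>. Y \<omega> $ i $ c * real_cond_exp M F (\<lambda>\<omega>. e \<omega> $ i $ c) \<omega> \<partial>M) = 0"
      by (rule integral_eq_zero_AE)
    then show ?thesis
      by (simp add: real_cond_exp_intg(2)[OF int])
  qed
  then show "(\<integral>\<omega>. Y \<omega> \<bullet> e \<omega> \<partial>M) = 0" "integrable M (\<lambda>\<omega>. Y \<omega> \<bullet> e \<omega>)"
    unfolding inner_vec_def inner_real_def
    by (auto simp: int intro!: Bochner_Integration.integrable_sum)
qed

text \<open>Integrating the conditional bound with the tower property; it comes in terms of nonnegative
  integrals, so that integrability is a conclusion.\<close>

lemma noise_second_moment:
  fixes e :: "'w \<Rightarrow> 'a::{real_inner, second_countable_topology} ^ 'n::finite"
  assumes "prob_space M" and sub: "subalgebra M F"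
    and e: "e \<in> borel_measurable M" and s: "0 \<le> s"
    and bound: "\<And>i. AE \<omega> in M. nn_cond_exp M F (\<lambda>\<omega>. ennreal ((norm (e \<omega> $ i))\<^sup>2)) \<omega> \<le> ennreal s"
  shows "integrable M (\<lambda>\<omega>. (norm (e \<omega>))\<^sup>2)" and "(\<integral>\<omega>. (norm (e \<omega>))\<^sup>2 \<partial>M) \<le> real CARD('n) * s"
proof -
  interpret prob_space M by fact
  interpret finite_measure_subalgebra M F
    by standard (rule sub)
  have [measurable]: "(\<lambda>\<omega>. e \<omega> $ i) \<in> borel_measurable M" for i
    by (rule measurable_compose[OF e]) (intro borel_measurable_continuous_onI continuous_intros)
  have nn: "(\<integral>\<^sup>+\<omega>. ennreal ((norm (e \<omega> $ i))\<^sup>2) \<partial>M) \<le> ennreal s" for i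
  proof -
    have "(\<integral>\<^sup>+\<omega>. ennreal ((norm (e \<omega> $ i))\<^sup>2) \<partial>M)
        = (\<integral>\<^sup>+\<omega>. nn_cond_exp M F (\<lambda>\<omega>. ennreal ((norm (e \<omega> $ i))\<^sup>2)) \<omega> \<partial>M)"
      using nn_cond_exp_intg[of "\<lambda>_. 1" "\<lambda>\<omega>. ennreal ((norm (e \<omega> $ i))\<^sup>2)"] by simp
    also have "\<dots> \<le> (\<integral>\<^sup>+\<omega>. ennreal s \<partial>M)"
      by (rule nn_integral_mono_AE[OF bound])
    finally show ?thesis
      by (simp add: emeasure_space_1)
  qed
  have int: "integrable M (\<lambda>\<omega>. (norm (e \<omega> $ i))\<^sup>2)" for i
    by (rule integrableI_bounded) (use nn[of i] in \<open>auto simp: le_less_trans\<close>)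
  have "(\<integral>\<omega>. (norm (e \<omega> $ i))\<^sup>2 \<partial>M) \<le> s" for i
    using nn[of i] s by (simp add: nn_integral_eq_integral[OF int])
  then have le: "(\<Sum>i\<in>UNIV. \<integral>\<omega>. (norm (e \<omega> $ i))\<^sup>2 \<partial>M) \<le> real CARD('n) * s"
    by (intro sum_bounded_above) auto
  have eq: "(norm (e \<omega>))\<^sup>2 = (\<Sum>i\<in>UNIV. (norm (e \<omega> $ i))\<^sup>2)" for \<omega>
    by (simp add: power2_norm_eq_inner inner_vec_def[of "e \<omega>"])
  show "integrable M (\<lambda>\<omega>. (norm (e \<omega>))\<^sup>2)" "(\<integral>\<omega>. (norm (e \<omega>))\<^sup>2 \<partial>M) \<le> real CARD('n) * s"
    unfolding eq using int le by simp_all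
qed

section \<open>The expected distance to the minimisers\<close>

text \<open>The noise is described by its variance and by its orthogonality to every square-integrable
  vector that is known at time \<open>k\<close>. The primal error \<open>z\<close> follows the dynamics only up to the two
  conditions \<open>z_step\<close>, which hold when \<open>z (Suc k)\<close> is a residual with respect to a new
  projection point. Integrability is part of the claim: that of the squared errors is passed on from step
  to step by the same inequality that gives the recursion.\<close>

lemma (in primal_dual) expectation_rate:
  fixes M :: "'w measure" and F :: "nat \<Rightarrow> 'w measure" and z w e \<zeta> G :: "nat \<Rightarrow> 'w \<Rightarrow> 'a"
    and \<gamma> s :: real
  defines "h \<equiv> \<lambda>k. \<gamma> / (real k + 1)"
  defines "p \<equiv> \<lambda>k \<omega>. - (\<alpha> *\<^sub>R \<Lambda> (z k \<omega> + e k \<omega>) + \<beta> *\<^sub>R w k \<omega> + G k \<omega> + \<zeta> k \<omega>)"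
    and "r \<equiv> \<lambda>k \<omega>. \<beta> *\<^sub>R \<Lambda> (z k \<omega> + e k \<omega>)"
  assumes sub: "\<And>k. subalgebra M (F k)"
    and z_meas: "\<And>k. z k \<in> borel_measurable (F k)" and w_meas: "\<And>k. w k \<in> borel_measurable (F k)"
    and w_S: "\<And>k \<omega>. \<omega> \<in> space M \<Longrightarrow> w k \<omega> \<in> S"
    and mono: "\<And>k \<omega>. \<omega> \<in> space M \<Longrightarrow> \<nu>\<^sub>1 * (norm (z k \<omega>))\<^sup>2 \<le> z k \<omega> \<bullet> (\<alpha> *\<^sub>R \<Lambda> (z k \<omega>) + G k \<omega>)"
    and lip: "\<And>k \<omega>. \<omega> \<in> space M \<Longrightarrow> norm (G k \<omega>) \<le> K * norm (z k \<omega>)"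
    and z_step: "\<And>k \<omega>. \<omega> \<in> space M \<Longrightarrow> norm (z (Suc k) \<omega>) \<le> norm (z k \<omega> + h k *\<^sub>R p k \<omega>)"
      "\<And>k \<omega>. \<omega> \<in> space M \<Longrightarrow>
        z (Suc k) \<omega> \<bullet> w (Suc k) \<omega> = (z k \<omega> + h k *\<^sub>R p k \<omega>) \<bullet> w (Suc k) \<omega>"
    and w_step: "\<And>k \<omega>. \<omega> \<in> space M \<Longrightarrow> w (Suc k) \<omega> = w k \<omega> + h k *\<^sub>R r k \<omega>"
    and init: "integrable M (\<lambda>\<omega>. (norm (z 0 \<omega>))\<^sup>2)" "integrable M (\<lambda>\<omega>. (norm (w 0 \<omega>))\<^sup>2)"
    and noise_sq: "\<And>k. integrable M (\<lambda>\<omega>. (norm (e k \<omega>))\<^sup>2 + (norm (\<zeta> k \<omega>))\<^sup>2)"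
      "\<And>k. (\<integral>\<omega>. (norm (e k \<omega>))\<^sup>2 + (norm (\<zeta> k \<omega>))\<^sup>2 \<partial>M) \<le> s"
    and e_orth: "\<And>k Y. Y \<in> borel_measurable (F k) \<Longrightarrow> integrable M (\<lambda>\<omega>. (norm (Y \<omega>))\<^sup>2) \<Longrightarrow>
        integrable M (\<lambda>\<omega>. Y \<omega> \<bullet> e k \<omega>) \<and> (\<integral>\<omega>. Y \<omega> \<bullet> e k \<omega> \<partial>M) = 0"
    and \<zeta>_orth: "\<And>k Y. Y \<in> borel_measurable (F k) \<Longrightarrow> integrable M (\<lambda>\<omega>. (norm (Y \<omega>))\<^sup>2) \<Longrightarrow>
        integrable M (\<lambda>\<omega>. Y \<omega> \<bullet> \<zeta> k \<omega>) \<and> (\<integral>\<omega>. Y \<omega> \<bullet> \<zeta> k \<omega> \<partial>M) = 0"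
    and \<gamma>: "2 * \<epsilon>\<^sub>3 / \<epsilon>\<^sub>2 < \<gamma>"
  shows "\<exists>C>0. \<forall>\<^sub>F k in sequentially.
      integrable M (\<lambda>\<omega>. (norm (z k \<omega>))\<^sup>2) \<and> (\<integral>\<omega>. (norm (z k \<omega>))\<^sup>2 \<partial>M) \<le> C / real k"
proof -
  have \<gamma>_pos: "0 < \<gamma>"
    using \<gamma> \<epsilon>\<^sub>2_pos \<epsilon>\<^sub>3_pos by (smt (verit) divide_pos_pos)
  then have h: "0 \<le> h k" for k
    by (simp add: h_def)
  obtain c where c: "0 < c" "\<And>z w. w \<in> S \<Longrightarrow> c * ((norm z)\<^sup>2 + (norm w)\<^sup>2) \<le> lyapunov z w"
    using lyapunov_lower by metis
  obtain D where D: "0 < D"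
    "\<And>z w e \<zeta> G. norm G \<le> K * norm z \<Longrightarrow>
      (norm (\<alpha> *\<^sub>R \<Lambda> (z + e) + \<beta> *\<^sub>R w + G + \<zeta>))\<^sup>2 + (norm (\<beta> *\<^sub>R \<Lambda> (z + e)))\<^sup>2
      \<le> D * (((norm z)\<^sup>2 + (norm w)\<^sup>2) + ((norm e)\<^sup>2 + (norm \<zeta>)\<^sup>2))"
    using increments_bound by metis
  define V where "V k \<omega> = lyapunov (z k \<omega>) (w k \<omega>)" for k \<omega>
  define N where "N k \<omega> = (norm (z k \<omega>))\<^sup>2 + (norm (w k \<omega>))\<^sup>2" for k \<omega>
  define U where "U k \<omega> = (norm (e k \<omega>))\<^sup>2 + (norm (\<zeta> k \<omega>))\<^sup>2" for k \<omega>
  define Y where "Y k \<omega> = (\<beta> - 2 * \<epsilon>\<^sub>1 * \<alpha>) *\<^sub>R \<Lambda> (z k \<omega>) + (2 * \<epsilon>\<^sub>1 * \<beta>) *\<^sub>R w k \<omega>" for k \<omega>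
  define Z where "Z k \<omega> = (2 * \<epsilon>\<^sub>1) *\<^sub>R z k \<omega> + w k \<omega>" for k \<omega>

  have \<Lambda>_borel: "\<Lambda> \<in> borel_measurable borel" and T_borel: "T \<in> borel_measurable borel"
    using linear_\<Lambda> linear_T
    by (auto intro!: borel_measurable_continuous_onI linear_continuous_on simp: linear_conv_bounded_linear)
  note [measurable] = z_meas w_meas measurable_from_subalg[OF sub z_meas] measurable_from_subalg[OF sub w_meas]
    measurable_compose[OF _ \<Lambda>_borel] measurable_compose[OF _ T_borel]
  have V_meas [measurable]: "V k \<in> borel_measurable M" for k
    unfolding V_def[abs_def] lyapunov_def by measurable
  have N_meas [measurable]: "N k \<in> borel_measurable M" for k
    unfolding N_def[abs_def] by measurable
  have YZ_meas: "Y k \<in> borel_measurable (F k)" "Z k \<in> borel_measurable (F k)" for k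
    unfolding Y_def[abs_def] Z_def[abs_def] by measurable

  have V_lower: "c * N k \<omega> \<le> V k \<omega>" and V_upper: "V k \<omega> \<le> \<epsilon>\<^sub>3 * N k \<omega>" if "\<omega> \<in> space M" for k \<omega>
    using c(2) lyapunov_upper w_S[OF that] by (auto simp: V_def N_def)
  have N_nonneg: "0 \<le> N k \<omega>" for k \<omega>
    by (simp add: N_def)
  have V_nonneg: "0 \<le> V k \<omega>" if "\<omega> \<in> space M" for k \<omega>
    using V_lower[OF that, of k] c(1) N_nonneg[of k \<omega>] by (smt (verit) mult_nonneg_nonneg)

  have step: "V (Suc k) \<omega> \<le> V k \<omega> - h k * \<epsilon>\<^sub>2 * N k \<omega> + h k * (Y k \<omega> \<bullet> e k \<omega> - Z k \<omega> \<bullet> \<zeta> k \<omega>)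
      + (h k)\<^sup>2 * (\<epsilon>\<^sub>3 * D) * (N k \<omega> + U k \<omega>)" if \<omega>: "\<omega> \<in> space M" for k \<omega>
  proof -
    have "V (Suc k) \<omega> \<le> lyapunov (z k \<omega> + h k *\<^sub>R p k \<omega>) (w (Suc k) \<omega>)"
      unfolding V_def by (rule lyapunov_mono[OF z_step[OF \<omega>]])
    also have "\<dots> \<le> V k \<omega> - h k * (\<epsilon>\<^sub>2 * N k \<omega>) + h k * (Y k \<omega> \<bullet> e k \<omega> - Z k \<omega> \<bullet> \<zeta> k \<omega>)
        + (h k)\<^sup>2 * lyapunov (p k \<omega>) (r k \<omega>)"
      unfolding V_def N_def Y_def Z_def w_step[OF \<omega>]
      by (rule lyapunov_decrease[OF w_S[OF \<omega>] mono[OF \<omega>] lip[OF \<omega>] h]) (simp_all add: p_def r_def)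
    also have "lyapunov (p k \<omega>) (r k \<omega>) \<le> \<epsilon>\<^sub>3 * D * (N k \<omega> + U k \<omega>)"
    proof -
      have "r k \<omega> \<in> S"
        unfolding r_def by (intro subspace_scale subspace_S range_\<Lambda>)
      then have "lyapunov (p k \<omega>) (r k \<omega>) \<le> \<epsilon>\<^sub>3 * ((norm (p k \<omega>))\<^sup>2 + (norm (r k \<omega>))\<^sup>2)"
        by (rule lyapunov_upper)
      also have "\<dots> \<le> \<epsilon>\<^sub>3 * (D * (N k \<omega> + U k \<omega>))"
        unfolding p_def r_def N_def U_def norm_minus_cancel
        using \<epsilon>\<^sub>3_pos by (intro mult_left_mono D(2) lip[OF \<omega>]) simp
      finally show ?thesis
        by (simp add: mult.assoc)
    qed
    finally show ?thesis
      by (simp add: mult.assoc mult_left_mono)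
  qed

  have noise: "integrable M (\<lambda>\<omega>. Y k \<omega> \<bullet> e k \<omega>) \<and> (\<integral>\<omega>. Y k \<omega> \<bullet> e k \<omega> \<partial>M) = 0"
      "integrable M (\<lambda>\<omega>. Z k \<omega> \<bullet> \<zeta> k \<omega>) \<and> (\<integral>\<omega>. Z k \<omega> \<bullet> \<zeta> k \<omega> \<partial>M) = 0"
    if N: "integrable M (N k)" for k
  proof -
    obtain B where B: "0 < B" "\<And>x. norm (\<Lambda> x) \<le> B * norm x"
      using linear_bounded_pos[OF linear_\<Lambda>] by blast
    have lin_sq: "integrable M (\<lambda>\<omega>. (norm (f (z k \<omega>) + b *\<^sub>R w k \<omega>))\<^sup>2)"
      if f: "\<And>x. norm (f x) \<le> a * norm x" and meas: "f \<in> borel_measurable borel"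
      for f :: "'a \<Rightarrow> 'a" and a b :: real
    proof (rule Bochner_Integration.integrable_bound)
      show "integrable M (\<lambda>\<omega>. (2 * a\<^sup>2 + 2 * b\<^sup>2) * N k \<omega>)"
        using N by simp
      note [measurable] = measurable_compose[OF _ meas]
      show "(\<lambda>\<omega>. (norm (f (z k \<omega>) + b *\<^sub>R w k \<omega>))\<^sup>2) \<in> borel_measurable M"
        by measurable
      show "AE \<omega> in M. norm ((norm (f (z k \<omega>) + b *\<^sub>R w k \<omega>))\<^sup>2) \<le> norm ((2 * a\<^sup>2 + 2 * b\<^sup>2) * N k \<omega>)"
      proof (intro AE_I2)
        fix \<omega>
        have "(norm (f (z k \<omega>) + b *\<^sub>R w k \<omega>))\<^sup>2 \<le> 2 * (norm (f (z k \<omega>)))\<^sup>2 + 2 * (norm (b *\<^sub>R w k \<omega>))\<^sup>2"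
          by (rule norm_add_squared_le)
        also have "\<dots> \<le> 2 * (a * norm (z k \<omega>))\<^sup>2 + 2 * (norm (b *\<^sub>R w k \<omega>))\<^sup>2"
          by (intro add_right_mono mult_left_mono power_mono f) auto
        also have "\<dots> = 2 * a\<^sup>2 * (norm (z k \<omega>))\<^sup>2 + 2 * b\<^sup>2 * (norm (w k \<omega>))\<^sup>2"
          by (simp add: power_mult_distrib)
        also have "\<dots> \<le> (2 * a\<^sup>2 + 2 * b\<^sup>2) * (norm (z k \<omega>))\<^sup>2 + (2 * a\<^sup>2 + 2 * b\<^sup>2) * (norm (w k \<omega>))\<^sup>2"
          by (intro add_mono mult_right_mono) auto
        also have "\<dots> = (2 * a\<^sup>2 + 2 * b\<^sup>2) * N k \<omega>"
          by (simp add: N_def distrib_left)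
        finally show "norm ((norm (f (z k \<omega>) + b *\<^sub>R w k \<omega>))\<^sup>2) \<le> norm ((2 * a\<^sup>2 + 2 * b\<^sup>2) * N k \<omega>)"
          by (simp add: abs_mult N_nonneg)
      qed
    qed
    have "norm ((\<beta> - 2 * \<epsilon>\<^sub>1 * \<alpha>) *\<^sub>R \<Lambda> x) \<le> (\<bar>\<beta> - 2 * \<epsilon>\<^sub>1 * \<alpha>\<bar> * B) * norm x" for x
      using mult_left_mono[OF B(2)[of x], of "\<bar>\<beta> - 2 * \<epsilon>\<^sub>1 * \<alpha>\<bar>"] by (simp add: mult.assoc)
    from lin_sq[OF this] have Y_sq: "integrable M (\<lambda>\<omega>. (norm (Y k \<omega>))\<^sup>2)"
      using \<Lambda>_borel unfolding Y_def by measurable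
    have "norm ((2 * \<epsilon>\<^sub>1) *\<^sub>R x) \<le> (2 * \<epsilon>\<^sub>1) * norm x" for x :: 'a
      using \<epsilon>\<^sub>1_pos by simp
    from lin_sq[OF this, of 1] have Z_sq: "integrable M (\<lambda>\<omega>. (norm (Z k \<omega>))\<^sup>2)"
      unfolding Z_def by simp
    show "integrable M (\<lambda>\<omega>. Y k \<omega> \<bullet> e k \<omega>) \<and> (\<integral>\<omega>. Y k \<omega> \<bullet> e k \<omega> \<partial>M) = 0"
        "integrable M (\<lambda>\<omega>. Z k \<omega> \<bullet> \<zeta> k \<omega>) \<and> (\<integral>\<omega>. Z k \<omega> \<bullet> \<zeta> k \<omega> \<partial>M) = 0"
      by (intro e_orth \<zeta>_orth YZ_meas Y_sq Z_sq)+
  qed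
  have U: "integrable M (U k)" "(\<integral>\<omega>. U k \<omega> \<partial>M) \<le> s" for k
    using noise_sq unfolding U_def by auto
  have V_int: "integrable M (V k)" if "integrable M (N k)" for k
  proof (rule Bochner_Integration.integrable_bound)
    show "integrable M (\<lambda>\<omega>. \<epsilon>\<^sub>3 * N k \<omega>)"
      using that by simp
    show "AE \<omega> in M. norm (V k \<omega>) \<le> norm (\<epsilon>\<^sub>3 * N k \<omega>)"
      using V_upper V_nonneg by (intro AE_I2) (smt (verit) real_norm_def)
  qed simp
  \<comment> \<open>The right-hand side of the one-step inequality \<open>step\<close>: it dominates \<open>c * N (Suc k)\<close>, so its
    integrability is inherited by the next squared errors.\<close>
  define R where "R k \<omega> = V k \<omega> - h k * \<epsilon>\<^sub>2 * N k \<omega> + h k * (Y k \<omega> \<bullet> e k \<omega> - Z k \<omega> \<bullet> \<zeta> k \<omega>)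
      + (h k)\<^sup>2 * (\<epsilon>\<^sub>3 * D) * (N k \<omega> + U k \<omega>)" for k \<omega>
  have R_int: "integrable M (R k)" if "integrable M (N k)" for k
    unfolding R_def using that V_int[OF that] noise[OF that] U(1)[of k] by simp
  have N_int: "integrable M (N k)" for k
  proof (induction k)
    case 0
    show ?case
      unfolding N_def using init by simp
  next
    case (Suc k)
    show ?case
    proof (rule Bochner_Integration.integrable_bound)
      show "integrable M (\<lambda>\<omega>. R k \<omega> / c)"
        using R_int[OF Suc] by simp
      show "AE \<omega> in M. norm (N (Suc k) \<omega>) \<le> norm (R k \<omega> / c)"
      proof (intro AE_I2)
        fix \<omega> assume \<omega>: "\<omega> \<in> space M"
        have "c * N (Suc k) \<omega> \<le> R k \<omega>"
          unfolding R_def by (rule order_trans[OF V_lower[OF \<omega>] step[OF \<omega>]])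
        then have "N (Suc k) \<omega> \<le> R k \<omega> / c"
          using c(1) by (simp add: field_simps)
        then show "norm (N (Suc k) \<omega>) \<le> norm (R k \<omega> / c)"
          using N_nonneg[of "Suc k" \<omega>] by (simp only: real_norm_def)
      qed
    qed simp
  qed

  \<comment> \<open>The expectations of \<open>V\<close> and \<open>N\<close> dominate each other up to constants, so the expected one-step
    inequality closes as a recursion for the expectation of \<open>V\<close> alone.\<close>
  define u where "u k = (\<integral>\<omega>. V k \<omega> \<partial>M)" for k
  define m where "m k = (\<integral>\<omega>. N k \<omega> \<partial>M)" for k
  have u_nonneg: "0 \<le> u k" for k
    unfolding u_def by (intro integral_nonneg_AE AE_I2 V_nonneg)
  have "c * m k \<le> u k" "u k \<le> \<epsilon>\<^sub>3 * m k" for k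
  proof -
    have "(\<integral>\<omega>. c * N k \<omega> \<partial>M) \<le> u k" "u k \<le> (\<integral>\<omega>. \<epsilon>\<^sub>3 * N k \<omega> \<partial>M)"
      unfolding u_def
      by (intro integral_mono_AE AE_I2 V_lower V_upper V_int N_int integrable_mult_right; assumption?)+
    then show "c * m k \<le> u k" "u k \<le> \<epsilon>\<^sub>3 * m k"
      by (simp_all add: m_def)
  qed
  then have m: "m k \<le> u k / c" "u k / \<epsilon>\<^sub>3 \<le> m k" for k
    using c(1) \<epsilon>\<^sub>3_pos by (simp_all add: field_simps)
  have rec: "u (Suc k) \<le> (1 - (\<gamma> * \<epsilon>\<^sub>2 / \<epsilon>\<^sub>3) / (real k + 1) + (\<gamma>\<^sup>2 * (\<epsilon>\<^sub>3 * D) / c) / (real k + 1)\<^sup>2) * u k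
      + (\<gamma>\<^sup>2 * (\<epsilon>\<^sub>3 * D) * s) / (real k + 1)\<^sup>2" for k
  proof -
    have "u (Suc k) \<le> (\<integral>\<omega>. R k \<omega> \<partial>M)"
      unfolding u_def R_def
      by (intro integral_mono_AE AE_I2 V_int R_int[unfolded R_def] N_int step)
    also have "\<dots> = u k - h k * \<epsilon>\<^sub>2 * m k + (h k)\<^sup>2 * (\<epsilon>\<^sub>3 * D) * (m k + (\<integral>\<omega>. U k \<omega> \<partial>M))"
      unfolding R_def u_def m_def
      using V_int[OF N_int] N_int[of k] noise[OF N_int, of k] U(1)[of k] by simp
    also have "\<dots> \<le> u k - h k * \<epsilon>\<^sub>2 * (u k / \<epsilon>\<^sub>3) + (h k)\<^sup>2 * (\<epsilon>\<^sub>3 * D) * (u k / c + s)"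
      using h \<epsilon>\<^sub>2_pos \<epsilon>\<^sub>3_pos D(1) by (intro add_mono diff_mono mult_left_mono m U) auto
    also have "\<dots> = (1 - (\<gamma> * \<epsilon>\<^sub>2 / \<epsilon>\<^sub>3) / (real k + 1) + (\<gamma>\<^sup>2 * (\<epsilon>\<^sub>3 * D) / c) / (real k + 1)\<^sup>2) * u k
      + (\<gamma>\<^sup>2 * (\<epsilon>\<^sub>3 * D) * s) / (real k + 1)\<^sup>2"
      by (simp add: h_def power_divide add_divide_distrib algebra_simps)
    finally show ?thesis .
  qed
  have "2 < \<gamma> * \<epsilon>\<^sub>2 / \<epsilon>\<^sub>3"
    using \<gamma> \<epsilon>\<^sub>2_pos \<epsilon>\<^sub>3_pos by (simp add: field_simps)
  from decay_rate_inverse[OF u_nonneg this rec]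
  obtain C where C: "0 < C" "\<forall>\<^sub>F k in sequentially. u k \<le> C / real k"
    by blast
  have z_int: "integrable M (\<lambda>\<omega>. (norm (z k \<omega>))\<^sup>2)" for k
    by (rule Bochner_Integration.integrable_bound[OF N_int[of k]]) (auto simp: N_def)
  have "(\<integral>\<omega>. (norm (z k \<omega>))\<^sup>2 \<partial>M) \<le> (C / c) / real k" if "u k \<le> C / real k" for k
  proof -
    have "(\<integral>\<omega>. (norm (z k \<omega>))\<^sup>2 \<partial>M) \<le> m k"
      unfolding m_def by (intro integral_mono_AE z_int N_int AE_I2) (simp add: N_def)
    also have "\<dots> \<le> u k / c"
      by (rule m)
    also have "\<dots> \<le> C / real k / c"
      using c(1) that by (intro divide_right_mono) auto
    finally show ?thesis
      by (simp add: ac_simps)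
  qed
  then have "\<forall>\<^sub>F k in sequentially. integrable M (\<lambda>\<omega>. (norm (z k \<omega>))\<^sup>2) \<and>
      (\<integral>\<omega>. (norm (z k \<omega>))\<^sup>2 \<partial>M) \<le> (C / c) / real k"
    using C(2) z_int by (auto elim: eventually_mono)
  moreover have "0 < C / c"
    using C(1) c(1) by simp
  ultimately show ?thesis
    by blast
qed

theorem theorem2:
  fixes f :: "'n::finite \<Rightarrow> real ^ 'd \<Rightarrow> real"
    and X :: "(real ^ 'd) set"
    and Lf_i :: "'n \<Rightarrow> real"
    and A L :: "real ^ 'n ^ 'n"
    and M :: "'w measure"
    and \<F> :: "nat \<Rightarrow> 'w measure"
    and x v q g \<zeta> :: "nat \<Rightarrow> 'w \<Rightarrow> real ^ 'd ^ 'n"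
    and x\<^sub>0 :: "real ^ 'd ^ 'n"
    and h :: "nat \<Rightarrow> real"
    and l u \<Delta> \<alpha> \<beta> \<gamma> \<nu> \<sigma> Lf \<rho> \<rho>\<^sub>2 \<nu>\<^sub>1 \<epsilon>\<^sub>1 \<epsilon>\<^sub>2 \<epsilon>\<^sub>3 n :: real
    and b :: nat
  assumes n: "n = real CARD('n)" "2 \<le> CARD('n)"
    and X: "X = minimizers (global_cost f)" "X \<noteq> {}" "convex X"
    and smooth: "\<And>i. continuously_differentiable (f i)"
      "\<And>i. Lf_i i > 0"
      "\<And>i y z. norm (gradient (f i) y - gradient (f i) z) \<le> Lf_i i * norm (y - z)"
      "Lf = Max (range Lf_i)"
    and rsi: "\<nu> > 0"
      "\<And>y. (gradient (global_cost f) y - gradient (global_cost f) (closest_point X y))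
              \<bullet> (y - closest_point X y) \<ge> \<nu> * (norm (y - closest_point X y))\<^sup>2"
    and grad_singleton: "is_singleton (gradient (stacked_cost f) ` (vec ` X))"
    and graph: "weighted_undirected_graph A" "graph_connected A"
      "L = laplacian A" "\<rho> = spectral_radius L" "\<rho>\<^sub>2 = min_nonzero_eigenvalue L"
    and prob: "prob_space M" "filtration (space M) \<F>" "\<And>k. subalgebra M (\<F> k)"
      "\<And>k. x k \<in> borel_measurable (\<F> k)" "\<And>k. v k \<in> borel_measurable (\<F> k)"
      "\<And>k. q k \<in> borel_measurable M" "\<And>k. \<zeta> k \<in> borel_measurable M"
    and quantizer: "l < u" "1 \<le> b" "\<Delta> = quant_step l u b"
      "\<And>k i c. random_quantization l u b M (\<F> k) (\<lambda>\<omega>. x k \<omega> $ i $ c) (\<lambda>\<omega>. q k \<omega> $ i $ c)"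
      "\<And>k i. AE \<omega> in M. vec_cond_exp M (\<F> k) (\<lambda>\<omega>. q k \<omega> $ i - x k \<omega> $ i) \<omega> = 0"
      "\<And>k i. AE \<omega> in M. nn_cond_exp M (\<F> k) (\<lambda>\<omega>. ennreal ((norm (q k \<omega> $ i - x k \<omega> $ i))\<^sup>2)) \<omega>
                 \<le> ennreal (real CARD('d) * \<Delta>\<^sup>2 / 4)"
    and stoch_grad: "\<And>k i \<omega>. \<omega> \<in> space M \<Longrightarrow> g k \<omega> $ i = gradient (f i) (x k \<omega> $ i) + \<zeta> k \<omega> $ i"
      "\<And>k i. AE \<omega> in M. vec_cond_exp M (\<F> k) (\<lambda>\<omega>. \<zeta> k \<omega> $ i) \<omega> = 0"
      "\<And>k i. AE \<omega> in M. nn_cond_exp M (\<F> k) (\<lambda>\<omega>. ennreal ((norm (\<zeta> k \<omega> $ i))\<^sup>2)) \<omega> \<le> ennreal (\<sigma>\<^sup>2)"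
    and algorithm: "\<And>\<omega>. \<omega> \<in> space M \<Longrightarrow> x 0 \<omega> = x\<^sub>0"
      "\<And>\<omega>. \<omega> \<in> space M \<Longrightarrow>
        q_pdgd_trajectory L \<alpha> \<beta> h (\<lambda>k. x k \<omega>) (\<lambda>k. v k \<omega>) (\<lambda>k. q k \<omega>) (\<lambda>k. g k \<omega>)"
    and constants: "\<nu>\<^sub>1 = min (\<nu> / (2 * n)) (\<alpha> * \<rho>\<^sub>2 - (2 * n * Lf\<^sup>2 + \<nu> * Lf) / \<nu>)"
      "\<epsilon>\<^sub>1 = max (1 / \<nu>\<^sub>1 * (Lf\<^sup>2 / (2 * \<beta>) + \<beta> * \<rho>)) (1 / 2)"
      "\<epsilon>\<^sub>2 = min (\<beta> / 2) (\<epsilon>\<^sub>1 * \<nu>\<^sub>1)"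
      "\<epsilon>\<^sub>3 = max (\<epsilon>\<^sub>1 + 1 / 2) (\<epsilon>\<^sub>1 / \<rho>\<^sub>2 + \<alpha> / (2 * \<beta>) + 1 / 2)"
    and parameters: "\<alpha> > (2 * n * Lf\<^sup>2 + \<nu> * Lf) / (\<nu> * \<rho>\<^sub>2)" "\<beta> > 0"
      "\<And>k. h k = \<gamma> / (real k + 1)" "\<gamma> > 2 * \<epsilon>\<^sub>3 / \<epsilon>\<^sub>2"
  shows "\<exists>C>0. \<forall>\<^sub>F k in sequentially.
           integrable M (\<lambda>\<omega>. (norm (x k \<omega> - closest_point (vec ` X) (x k \<omega>)))\<^sup>2) \<and>
           prob_space.expectation M (\<lambda>\<omega>. (norm (x k \<omega> - closest_point (vec ` X) (x k \<omega>)))\<^sup>2)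
             \<le> C / real k"
proof -
  interpret prob_space M by (rule prob(1))
  define N where "N = real CARD('n)"
  have N: "n = N" "0 < N"
    using n by (simp_all add: N_def)
  define \<Lambda> where "\<Lambda> = (kron L :: real ^ 'd ^ 'n \<Rightarrow> real ^ 'd ^ 'n)"
  define Gr where "Gr u = (\<chi> i. gradient (f i) (u $ i))" for u :: "real ^ 'd ^ 'n"

  have diff: "f i differentiable (at y)" for i y
    using smooth(1) by (simp add: continuously_differentiable_def)
  have grad_sum: "GDERIV (global_cost f) y :> (\<Sum>i\<in>UNIV. gradient (f i) y)" for y
    by (rule gradient_global_cost) (rule diff)
  have "continuous_on UNIV (global_cost f)"
    using grad_sum by (auto simp: gderiv_def intro!: continuous_at_imp_continuous_on has_derivative_continuous)
  then have X_closed: "closed X"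
    unfolding X(1) by (rule closed_minimizers)
  have stationary: "(\<Sum>i\<in>UNIV. gradient (f i) y) = 0" if "y \<in> X" for y
    using that unfolding X(1) by (rule gradient_minimizer) (rule grad_sum)
  have "gradient (stacked_cost f) u = Gr u" for u
    unfolding Gr_def by (intro gradient_eq gradient_stacked_cost diff)
  then obtain gs where gs: "Gr (vec y) = gs" if "y \<in> X" for y
    using grad_singleton unfolding is_singleton_def by (metis image_eqI singletonD)
  have gs_dis: "gs \<in> disagreement"
    using X(2) gs stationary by (force simp: disagreement_def Gr_def)

  have Lf_ge: "Lf_i i \<le> Lf" for i
    unfolding smooth(4) by (intro Max_ge) auto
  have Lf_pos: "0 < Lf"
    using Lf_ge smooth(2) less_le_trans by blast
  have lip: "norm (gradient (f i) y - gradient (f i) z) \<le> Lf * norm (y - z)" for i y z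
    using smooth(3)[of i y z] mult_right_mono[OF Lf_ge[of i] norm_ge_zero[of "y - z"]] by linarith

  note A = graph(1,2) n(2)
  have \<rho>\<^sub>2: "0 < \<rho>\<^sub>2" "\<rho>\<^sub>2 \<le> \<rho>"
    unfolding graph(3-5) by (rule min_nonzero_eigenvalue_laplacian[OF A])+
  \<comment> \<open>The part of the spectral gap \<open>\<alpha> * \<rho>\<^sub>2\<close> that compensates the non-monotonicity of the single
    gradients; the bound on \<open>\<alpha>\<close> says that the gap exceeds it.\<close>
  define a where "a = (2 * n * Lf\<^sup>2 + \<nu> * Lf) / \<nu>"
  have a: "0 < a"
    unfolding a_def using N rsi(1) Lf_pos by (intro divide_pos_pos add_pos_pos mult_pos_pos) auto
  have "a / \<rho>\<^sub>2 < \<alpha>"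
    using parameters(1) by (simp add: a_def)
  then have gap: "a < \<alpha> * \<rho>\<^sub>2" and \<alpha>: "0 < \<alpha>"
    using \<rho>\<^sub>2(1) a by (auto simp: pos_divide_less_eq intro: less_trans[OF divide_pos_pos])
  have \<nu>\<^sub>1: "0 < \<nu>\<^sub>1" "\<nu>\<^sub>1 < \<alpha> * \<rho>"
  proof -
    show "0 < \<nu>\<^sub>1"
      using gap N rsi(1) by (simp add: constants(1) a_def)
    have "\<nu>\<^sub>1 \<le> \<alpha> * \<rho>\<^sub>2 - a"
      by (simp add: constants(1) a_def)
    also have "\<dots> < \<alpha> * \<rho>\<^sub>2"
      using a by simp
    also have "\<dots> \<le> \<alpha> * \<rho>"
      using \<rho>\<^sub>2(2) \<alpha> by simp
    finally show "\<nu>\<^sub>1 < \<alpha> * \<rho>" .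
  qed
  obtain T :: "real ^ 'd ^ 'n \<Rightarrow> real ^ 'd ^ 'n" where T: "linear T" "\<And>x y. T x \<bullet> y = x \<bullet> T y"
    "\<And>w. w \<in> disagreement \<Longrightarrow> \<Lambda> (T w) = w"
    "\<And>w. w \<in> disagreement \<Longrightarrow> w \<bullet> T w \<le> (norm w)\<^sup>2 / \<rho>\<^sub>2"
    using laplacian_pseudoinverse[OF A] unfolding \<Lambda>_def graph(3,5) by blast
  have \<Lambda>_self: "\<Lambda> u \<bullet> u' = u \<bullet> \<Lambda> u'" for u u'
    unfolding \<Lambda>_def graph(3) by (rule kron_self_adjoint[OF laplacian_symmetric[OF graph(1)]])
  have \<Lambda>_dis: "\<Lambda> u \<in> disagreement" for u
    unfolding \<Lambda>_def graph(3) by (rule kron_laplacian_disagreement[OF graph(1)])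
  have \<Lambda>_vec: "\<Lambda> (vec y) = 0" for y
    unfolding \<Lambda>_def graph(3) by (rule kron_laplacian_consensus)
  have \<Lambda>_lin: "linear \<Lambda>"
    unfolding \<Lambda>_def by (rule linear_kron)
  interpret primal_dual \<Lambda> T disagreement \<alpha> \<beta> \<rho> \<rho>\<^sub>2 Lf \<nu>\<^sub>1 \<epsilon>\<^sub>1 \<epsilon>\<^sub>2 \<epsilon>\<^sub>3
  proof (rule primal_dual.intro)
    show "0 \<le> u \<bullet> \<Lambda> u" "u \<bullet> \<Lambda> u \<le> \<rho> * (norm u)\<^sup>2" for u
      unfolding \<Lambda>_def graph(3,4)
      by (rule kron_laplacian_nonneg[OF graph(1)], rule kron_laplacian_le[OF graph(1)])
  qed (rule T \<Lambda>_lin \<Lambda>_self \<Lambda>_dis \<rho>\<^sub>2(1) \<alpha> parameters(2) less_imp_le[OF Lf_pos] \<nu>\<^sub>1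
      constants(2-4) subspace_disagreement; assumption?)+

  define P where "P u = closest_point X (average u)" for u :: "real ^ 'd ^ 'n"
  have P_X: "P u \<in> X" for u
    unfolding P_def by (rule closest_point_in_set[OF X_closed X(2)])
  define z where "z k \<omega> = x k \<omega> - vec (P (x k \<omega>))" for k \<omega>
  \<comment> \<open>The multiplier at which the drift of \<open>x\<close> vanishes on the consensual minimisers.\<close>
  define vs where "vs = - ((1 / \<beta>) *\<^sub>R gs)"
  define w where "w k \<omega> = v k \<omega> - vs" for k \<omega>
  define e where "e k \<omega> = q k \<omega> - x k \<omega>" for k \<omega>
  define G where "G k \<omega> = Gr (x k \<omega>) - gs" for k \<omega>

  have x_step: "x (Suc k) \<omega> = x k \<omega> - h k *\<^sub>R (\<alpha> *\<^sub>R \<Lambda> (q k \<omega>) + \<beta> *\<^sub>R v k \<omega> + g k \<omega>)"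
    and v_step: "v (Suc k) \<omega> = v k \<omega> + (h k * \<beta>) *\<^sub>R \<Lambda> (q k \<omega>)"
    and v_init: "v 0 \<omega> = 0" if "\<omega> \<in> space M" for k \<omega>
    using algorithm(2)[OF that] by (simp_all add: q_pdgd_trajectory_def vec_eq_iff \<Lambda>_def kron_def)
  have v_dis: "v k \<omega> \<in> disagreement" if "\<omega> \<in> space M" for k \<omega>
  proof (induction k)
    case 0
    show ?case
      using v_init[OF that] by (simp add: subspace_0[OF subspace_disagreement])
  next
    case (Suc k)
    then show ?case
      unfolding v_step[OF that] by (intro subspace_add subspace_scale subspace_disagreement \<Lambda>_dis)
  qed
  have vs_dis: "vs \<in> disagreement"
    unfolding vs_def by (intro subspace_neg subspace_scale subspace_disagreement gs_dis)
  have w_dis: "w k \<omega> \<in> disagreement" if "\<omega> \<in> space M" for k \<omega>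
    unfolding w_def by (intro subspace_diff subspace_disagreement v_dis[OF that] vs_dis)
  have \<Lambda>_q: "\<Lambda> (q k \<omega>) = \<Lambda> (z k \<omega> + e k \<omega>)" for k \<omega>
    by (simp add: z_def e_def linear_add[OF \<Lambda>_lin] linear_diff[OF \<Lambda>_lin] \<Lambda>_vec)
  \<comment> \<open>Rewritten for the errors: the shift of \<open>v\<close> by \<open>vs\<close> cancels the gradient at the projection.\<close>
  have x_step': "x (Suc k) \<omega> = x k \<omega> + h k *\<^sub>R
      - (\<alpha> *\<^sub>R \<Lambda> (z k \<omega> + e k \<omega>) + \<beta> *\<^sub>R w k \<omega> + G k \<omega> + \<zeta> k \<omega>)" if "\<omega> \<in> space M" for k \<omega>
  proof -
    have g: "g k \<omega> = Gr (x k \<omega>) + \<zeta> k \<omega>"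
      using stoch_grad(1)[OF that] by (simp add: vec_eq_iff Gr_def)
    have v: "\<beta> *\<^sub>R v k \<omega> = \<beta> *\<^sub>R w k \<omega> - gs"
      using parameters(2) by (simp add: w_def vs_def scaleR_diff_right scaleR_add_right)
    show ?thesis
      unfolding x_step[OF that] \<Lambda>_q g v G_def by (simp add: algebra_simps)
  qed
  have residual_shift: "(u - vec y) \<bullet> w k \<omega> = u \<bullet> w k \<omega>" if "\<omega> \<in> space M" for u y k \<omega>
    using inner_consensus_disagreement[OF w_dis[OF that]] by (simp add: inner_diff_left)

  have P_cont: "continuous_on UNIV (\<lambda>u :: real ^ 'd ^ 'n. u - vec (P u))"
  proof -
    have "linear (average :: real ^ 'd ^ 'n \<Rightarrow> real ^ 'd)"
      by (rule linearI) (simp_all add: average_def sum.distrib scaleR_add_right flip: scaleR_sum_right)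
    then have "continuous_on UNIV (average :: real ^ 'd ^ 'n \<Rightarrow> real ^ 'd)"
      by (simp add: linear_continuous_on linear_conv_bounded_linear)
    then have "continuous_on UNIV (P :: real ^ 'd ^ 'n \<Rightarrow> real ^ 'd)"
      unfolding P_def
      by (rule continuous_on_compose2[OF continuous_on_closest_point[OF X(3) X_closed X(2)]]) auto
    then show ?thesis
      by (intro continuous_intros linear_continuous_on_compose[OF _ linear_vec])
  qed
  have \<Delta>: "0 \<le> real CARD('d) * \<Delta>\<^sup>2 / 4"
    by simp
  have x_M: "x k \<in> borel_measurable M" for k
    by (rule measurable_from_subalg[OF prob(3,4)])
  have e_M: "e k \<in> borel_measurable M" for k
    unfolding e_def using prob(6) x_M by (intro borel_measurable_diff) auto
  note e_sq = noise_second_moment[OF prob(1,3) e_M \<Delta>, unfolded e_def vector_minus_component, OF quantizer(6),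
      folded e_def]
  note \<zeta>_sq = noise_second_moment[OF prob(1,3,7) zero_le_power2 stoch_grad(3)]
  define s where "s = N * (real CARD('d) * \<Delta>\<^sup>2 / 4) + N * \<sigma>\<^sup>2"

  have "\<exists>C>0. \<forall>\<^sub>F k in sequentially.
      integrable M (\<lambda>\<omega>. (norm (z k \<omega>))\<^sup>2) \<and> (\<integral>\<omega>. (norm (z k \<omega>))\<^sup>2 \<partial>M) \<le> C / real k"
  proof (rule expectation_rate[where F = \<F> and w = w and e = e and \<zeta> = \<zeta> and G = G and \<gamma> = \<gamma> and s = s])
    show "subalgebra M (\<F> k)" for k
      by (fact prob)
    show "z k \<in> borel_measurable (\<F> k)" for k
      unfolding z_def
      by (rule measurable_compose[OF prob(4) borel_measurable_continuous_onI[OF P_cont]])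
    show "w k \<in> borel_measurable (\<F> k)" for k
      unfolding w_def using prob(5) by (intro borel_measurable_diff) auto
    show "2 * \<epsilon>\<^sub>3 / \<epsilon>\<^sub>2 < \<gamma>"
      by (fact parameters)
    show "integrable M (\<lambda>\<omega>. (norm (e k \<omega>))\<^sup>2 + (norm (\<zeta> k \<omega>))\<^sup>2)"
      "(\<integral>\<omega>. (norm (e k \<omega>))\<^sup>2 + (norm (\<zeta> k \<omega>))\<^sup>2 \<partial>M) \<le> s" for k
      using e_sq[of k] \<zeta>_sq[of k] by (auto simp: s_def N_def)
    show "integrable M (\<lambda>\<omega>. Y \<omega> \<bullet> e k \<omega>) \<and> (\<integral>\<omega>. Y \<omega> \<bullet> e k \<omega> \<partial>M) = 0"
      if "Y \<in> borel_measurable (\<F> k)" "integrable M (\<lambda>\<omega>. (norm (Y \<omega>))\<^sup>2)" for k Y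
      by (intro conjI inner_noise_expectation[OF prob(1,3) that(1) e_M that(2) e_sq(1)])
        (simp_all add: e_def quantizer(5))
    show "integrable M (\<lambda>\<omega>. Y \<omega> \<bullet> \<zeta> k \<omega>) \<and> (\<integral>\<omega>. Y \<omega> \<bullet> \<zeta> k \<omega> \<partial>M) = 0"
      if "Y \<in> borel_measurable (\<F> k)" "integrable M (\<lambda>\<omega>. (norm (Y \<omega>))\<^sup>2)" for k Y
      by (intro conjI inner_noise_expectation[OF prob(1,3) that(1) prob(7) that(2) \<zeta>_sq(1)] stoch_grad(2))
    have "z 0 \<omega> = x\<^sub>0 - vec (P x\<^sub>0)" "w 0 \<omega> = - vs" if "\<omega> \<in> space M" for \<omega>
      using algorithm(1)[OF that] v_init[OF that] by (simp_all add: z_def w_def)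
    then show "integrable M (\<lambda>\<omega>. (norm (z 0 \<omega>))\<^sup>2)" "integrable M (\<lambda>\<omega>. (norm (w 0 \<omega>))\<^sup>2)"
      by (simp_all cong: Bochner_Integration.integrable_cong)
    fix k \<omega> assume \<omega>: "\<omega> \<in> space M"
    show "w k \<omega> \<in> disagreement"
      by (rule w_dis[OF \<omega>])
    have G: "G k \<omega> = Gr (x k \<omega>) - Gr (vec (P (x k \<omega>)))"
      by (simp add: G_def gs[OF P_X])
    show "norm (G k \<omega>) \<le> Lf * norm (z k \<omega>)"
      unfolding G z_def Gr_def by (rule lipschitz_stacked[OF lip]) (use Lf_pos in simp)
    show "\<nu>\<^sub>1 * (norm (z k \<omega>))\<^sup>2 \<le> z k \<omega> \<bullet> (\<alpha> *\<^sub>R \<Lambda> (z k \<omega>) + G k \<omega>)"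
    proof -
      have "\<nu> * (norm (average (x k \<omega>) - P (x k \<omega>)))\<^sup>2
          \<le> ((\<Sum>i\<in>UNIV. gradient (f i) (average (x k \<omega>))) - (\<Sum>i\<in>UNIV. gradient (f i) (P (x k \<omega>))))
            \<bullet> (average (x k \<omega>) - P (x k \<omega>))"
        using rsi(2)[of "average (x k \<omega>)"] by (simp add: P_def gradient_eq[OF grad_sum])
      moreover have "\<rho>\<^sub>2 * (norm d)\<^sup>2 \<le> d \<bullet> \<Lambda> d" if "d \<in> disagreement" for d
        unfolding \<Lambda>_def graph(3,5) by (rule kron_laplacian_ge[OF A that])
      ultimately show ?thesis
        using restricted_strong_monotonicity[OF \<Lambda>_lin \<Lambda>_self \<Lambda>_vec _ lip less_imp_le[OF Lf_pos] rsi(1)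
            less_imp_le[OF \<alpha>], of \<rho>\<^sub>2 "x k \<omega>" "P (x k \<omega>)"]
        unfolding G z_def Gr_def constants(1) n(1) by simp
    qed
    let ?p = "- (\<alpha> *\<^sub>R \<Lambda> (z k \<omega> + e k \<omega>) + \<beta> *\<^sub>R w k \<omega> + G k \<omega> + \<zeta> k \<omega>)"
    have u: "z k \<omega> + (\<gamma> / (real k + 1)) *\<^sub>R ?p = x (Suc k) \<omega> - vec (P (x k \<omega>))"
      unfolding x_step'[OF \<omega>] parameters(3) by (simp add: z_def)
    show "norm (z (Suc k) \<omega>) \<le> norm (z k \<omega> + (\<gamma> / (real k + 1)) *\<^sub>R ?p)"
      unfolding u unfolding z_def P_def[of "x (Suc k) \<omega>"] by (rule closest_consensus_le[OF X_closed P_X])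
    show "z (Suc k) \<omega> \<bullet> w (Suc k) \<omega> = (z k \<omega> + (\<gamma> / (real k + 1)) *\<^sub>R ?p) \<bullet> w (Suc k) \<omega>"
      unfolding u unfolding z_def residual_shift[OF \<omega>] ..
    show "w (Suc k) \<omega> = w k \<omega> + (\<gamma> / (real k + 1)) *\<^sub>R \<beta> *\<^sub>R \<Lambda> (z k \<omega> + e k \<omega>)"
      unfolding w_def v_step[OF \<omega>] \<Lambda>_q parameters(3) by simp
  qed
  then show ?thesis
    unfolding z_def P_def closest_point_consensus[OF X(3) X_closed X(2)] .
qed

end
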